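(* Let $G$ be a graph and $q,k\ge 1$. The following are equivalent: (1) Cop has a winning strategy in the monotone game $\mathrm{monCR}^k_q(G)$; (2) Cop has a winning strategy in the game $\mathrm{CR}^k_q(G)$; (3) $G\in\mathcal{T}^k_q$.
   Context: All graphs are finite, simple and loopless. The $q$-round $k$-cops Cops-and-Robber game $\mathrm{CR}^k_q(G)$: Cop positions are sets $X\subseteq V(G)$ with $|X|\le k$, Robber positions are vertices. For $X$ and $v$ let $\mathrm{esc}(X,v)=\{v\}$ if $v\in X$, and otherwise the vertex set of the connected component of $G-X$ containing $v$. Initially Cop is on $X_0=\emptyset$ and Robber chooses a vertex. In round $i$, Cop moves from $X_{i-1}$ to some $X_i$ with $|X_i|\le k$ and $|X_i\setminus X_{i-1}|\le 1$, then Robber moves from his current vertex $v$ to any $u\in\mathrm{esc}(X_i\cap X_{i-1},v)$. Cop wins if at some point a position $(X,u)$ with $u\in X$ is reached (Robber caught); Robber wins if Cop has not won after $q$ rounds. The monotone game $\mathrm{monCR}^k_q(G)$ is the same except Cop must always play so that $\mathrm{esc}(X_i\cap X_{i-1},v)=\mathrm{esc}(X_i,v)$ in each move. A $k$-pebble forest cover of $G$ is a rooted forest on $V(G)$ (with ancestor order $\preceq$) and $p\colon V(G)\to\{1,\dots,k\}$ such that every edge joins $\preceq$-comparable vertices and if $uv\in E(G)$, $u\prec v$, then $p(u)\ne p(w)$ for all $w$ with $u\prec w\preceq v$; its depth is the maximum number of vertices on a root-to-leaf path. $\mathcal{T}^k_q$ is the class of graphs admitting a $k$-pebble forest cover of depth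 at most $q$.
   Formalization: The monotone rule is corrected to esc(X_i ∩ X_{i-1}, v) = esc(X_{i-1}, v); with the printed esc(X_i, v) on the right the claim is false, e.g. for K_2 with k = q = 2, where Cop could never place a cop, so (1) fails while (2) and (3) hold. *)

theory Defs
  imports Graph_Theory.Graph_Theory
begin

text \<open>
  A finite simple loopless graph is a \<open>pair_graph\<close>: an undirected edge \<open>uv\<close> is the pair of
  opposite arcs \<open>(u, v)\<close> and \<open>(v, u)\<close>. Reachability is then symmetric, so the vertices
  reachable from \<open>v\<close> in \<open>G - X\<close> form the connected component of \<open>v\<close>.
\<close>

definition esc :: "'a pair_pre_digraph \<Rightarrow> 'a set \<Rightarrow> 'a \<Rightarrow> 'a set" where
  "esc G X v =
     (if v \<in> X then {v}
      else {u. v \<rightarrow>\<^sup>*\<^bsub>with_proj G \<restriction> (pverts G - X)\<^esub> u})"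

type_synonym 'a position = "'a set \<times> 'a"

definition caught :: "'a position \<Rightarrow> bool" where
  "caught P \<longleftrightarrow> snd P \<in> fst P"

text \<open>
  A rule says whether Cop may move from \<open>X\<close> to \<open>Y\<close> while Robber is on \<open>v\<close>.
\<close>

type_synonym 'a cop_rule = "'a set \<Rightarrow> 'a \<Rightarrow> 'a set \<Rightarrow> bool"

definition CR_rule :: "'a pair_pre_digraph \<Rightarrow> nat \<Rightarrow> 'a cop_rule" where
  "CR_rule G k X v Y \<longleftrightarrow> Y \<subseteq> pverts G \<and> card Y \<le> k \<and> card (Y - X) \<le> 1"

text \<open>
  Monotonicity compares with the position \<open>X\<close> that Cop leaves: lifting the cops of \<open>X - Y\<close>
  must not enlarge Robber's escape space. The condition is sometimes written with the new
  position, as \<open>esc G (Y \<inter> X) v = esc G Y v\<close>. Taken literally, that would forbid Cop to place a cop in a component with more than one vertex that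
  contains Robber, since the new vertex belongs to the former set but not to the latter
  (and if it is \<open>v\<close> itself, the latter is \<open>{v}\<close>).
\<close>

definition monCR_rule :: "'a pair_pre_digraph \<Rightarrow> nat \<Rightarrow> 'a cop_rule" where
  "monCR_rule G k X v Y \<longleftrightarrow> CR_rule G k X v Y \<and> esc G (Y \<inter> X) v = esc G X v"

text \<open>
  A strategy of Cop may depend on the whole history, which lists the positions reached so far
  in chronological order. After \<open>i\<close> rounds a history has length \<open>i + 1\<close>. The set
  \<open>histories G \<sigma>\<close> contains those consistent with \<open>\<sigma>\<close>; they are not continued after a capture.
\<close>

type_synonym 'a cop_strategy = "'a position list \<Rightarrow> 'a set"

inductive_set histories :: "'a pair_pre_digraph \<Rightarrow> 'a cop_strategy \<Rightarrow> 'a position list set"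
  for G :: "'a pair_pre_digraph" and \<sigma> :: "'a cop_strategy" where
  start: "v \<in> pverts G \<Longrightarrow> [({}, v)] \<in> histories G \<sigma>"
| round: "\<lbrakk>h \<in> histories G \<sigma>; last h = (X, v); \<not> caught (X, v); u \<in> esc G (\<sigma> h \<inter> X) v\<rbrakk>
          \<Longrightarrow> h @ [(\<sigma> h, u)] \<in> histories G \<sigma>"

definition winning_strategy ::
  "'a pair_pre_digraph \<Rightarrow> 'a cop_rule \<Rightarrow> nat \<Rightarrow> 'a cop_strategy \<Rightarrow> bool" where
  "winning_strategy G rule q \<sigma> \<longleftrightarrow>
     (\<forall>h \<in> histories G \<sigma>. length h \<le> q \<and> \<not> caught (last h) \<longrightarrow>
        rule (fst (last h)) (snd (last h)) (\<sigma> h)) \<and>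
     (\<forall>h \<in> histories G \<sigma>. length h = q + 1 \<longrightarrow> caught (last h))"

definition cop_wins_CR :: "nat \<Rightarrow> nat \<Rightarrow> 'a pair_pre_digraph \<Rightarrow> bool" where
  "cop_wins_CR k q G \<longleftrightarrow> (\<exists>\<sigma>. winning_strategy G (CR_rule G k) q \<sigma>)"

definition cop_wins_monCR :: "nat \<Rightarrow> nat \<Rightarrow> 'a pair_pre_digraph \<Rightarrow> bool" where
  "cop_wins_monCR k q G \<longleftrightarrow> (\<exists>\<sigma>. winning_strategy G (monCR_rule G k) q \<sigma>)"

text \<open>
  A rooted forest on \<open>V\<close> is given by its set \<open>F\<close> of pairs (parent, child). The ancestor order
  \<open>u \<preceq> v\<close> is \<open>(u, v) \<in> F\<^sup>*\<close>, and \<open>u \<prec> v\<close> is \<open>(u, v) \<in> F\<^sup>+\<close>.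
\<close>

definition rooted_forest :: "'a set \<Rightarrow> 'a rel \<Rightarrow> bool" where
  "rooted_forest V F \<longleftrightarrow>
     F \<subseteq> V \<times> V \<and> acyclic F \<and> (\<forall>u u' v. (u, v) \<in> F \<and> (u', v) \<in> F \<longrightarrow> u = u')"

definition root_leaf_paths :: "'a set \<Rightarrow> 'a rel \<Rightarrow> 'a list set" where
  "root_leaf_paths V F =
     {xs. xs \<noteq> [] \<and> set xs \<subseteq> V \<and> hd xs \<notin> Range F \<and> last xs \<notin> Domain F \<and>
          successively (\<lambda>u v. (u, v) \<in> F) xs}"

text \<open>The inserted \<open>0\<close> only matters for the empty forest.\<close>

definition forest_depth :: "'a set \<Rightarrow> 'a rel \<Rightarrow> nat" where
  "forest_depth V F = Max (insert 0 (length ` root_leaf_paths V F))"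

definition pebble_forest_cover ::
  "nat \<Rightarrow> 'a pair_pre_digraph \<Rightarrow> 'a rel \<Rightarrow> ('a \<Rightarrow> nat) \<Rightarrow> bool" where
  "pebble_forest_cover k G F p \<longleftrightarrow>
     rooted_forest (pverts G) F \<and>
     p ` pverts G \<subseteq> {1..k} \<and>
     (\<forall>(u, v) \<in> parcs G. (u, v) \<in> F\<^sup>* \<or> (v, u) \<in> F\<^sup>*) \<and>
     (\<forall>(u, v) \<in> parcs G. (u, v) \<in> F\<^sup>+ \<longrightarrow>
        (\<forall>w. (u, w) \<in> F\<^sup>+ \<and> (w, v) \<in> F\<^sup>* \<longrightarrow> p u \<noteq> p w))"

definition bounded_forest_cover_class :: "nat \<Rightarrow> nat \<Rightarrow> 'a pair_pre_digraph set" where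
  "bounded_forest_cover_class k q =
     {G. pair_graph G \<and>
         (\<exists>F p. pebble_forest_cover k G F p \<and> forest_depth (pverts G) F \<le> q)}"

end

theory Submission
  imports Defs
begin

text \<open>
  A winning strategy of Cop in the non-monotone game is turned into a monotone one by uncrossing.
  We keep a partial tree decomposition of width \<open>k - 1\<close> in which the union of the bags
  along a branch has at most \<open>q\<close> elements. Its leaves are regions \<open>D\<close> that lie in the
  escape space of a position from which Cop still wins in the remaining rounds. Initially the
  components of \<open>G\<close> are the leaves; at the end no round remains, so there are no leaves left.

  To expand a leaf \<open>D\<close>, let Cop's strategy move from \<open>Y\<close> to \<open>Y'\<close> there, and among the sets
  \<open>K\<close> between \<open>D\<close> and the component of \<open>G - (Y \<inter> Y')\<close> around \<open>D\<close> choose one whose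
  neighbourhood \<open>S\<close> is smallest. Rebuild the decomposition on \<open>G - K\<close>, replacing in each bag
  its vertices in \<open>K\<close> by the vertices of \<open>S\<close> that it separates from \<open>D\<close>, and let the leaf be
  \<open>K\<close>. Since \<open>S\<close> is smallest, submodularity shows that neither a bag nor a union of bags along a
  branch grows. Finally \<open>K\<close> is split by the bag \<open>S \<union> (Y' \<inter> K)\<close>, which costs one vertex, as does
  the round. The same uncrossing inequality controls width and depth.
\<close>

section \<open>Neighbourhoods, escape spaces and positional wins\<close>

definition nbhd :: "'a pair_pre_digraph \<Rightarrow> 'a set \<Rightarrow> 'a set" where
  "nbhd G R = {b. b \<notin> R \<and> (\<exists>a\<in>R. (a, b) \<in> parcs G)}"

lemma nbhd_disjoint: "nbhd G R \<inter> R = {}"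
  by (auto simp: nbhd_def)

lemma nbhd_Diff_subset: "nbhd G (R - A) \<subseteq> nbhd G R \<union> A"
  by (auto simp: nbhd_def)

section \<open>Winning from a position within a given number of rounds\<close>

fun cop_win :: "'a pair_pre_digraph \<Rightarrow> 'a cop_rule \<Rightarrow> nat \<Rightarrow> 'a set \<Rightarrow> 'a \<Rightarrow> bool" where
  "cop_win G rule 0 X v \<longleftrightarrow> v \<in> X"
| "cop_win G rule (Suc j) X v \<longleftrightarrow>
     v \<in> X \<or> (\<exists>Y. rule X v Y \<and> (\<forall>u \<in> esc G (Y \<inter> X) v. cop_win G rule j Y u))"

lemma cop_win_caught: "v \<in> X \<Longrightarrow> cop_win G rule j X v"
  by (cases j) auto

lemma cop_win_rule_mono:
  assumes "\<And>X v Y. rule X v Y \<Longrightarrow> rule' X v Y"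
  shows "cop_win G rule j X v \<Longrightarrow> cop_win G rule' j X v"
proof (induction j arbitrary: X v)
  case (Suc j)
  then show ?case using assms by (metis cop_win.simps(2))
qed simp

text \<open>A history influences the rest of the game only through its last position and the number
  of rounds left. So a strategy gives positional wins by induction on the remaining rounds, and
  positional wins give a strategy by choosing, after each history, a move that keeps the position
  winning.\<close>

lemma cop_win_iff_strategy:
  "(\<exists>\<sigma>. winning_strategy G rule q \<sigma>) \<longleftrightarrow> (\<forall>v \<in> pverts G. cop_win G rule q {} v)"
proof
  assume "\<exists>\<sigma>. winning_strategy G rule q \<sigma>"
  then obtain \<sigma> where
    rule: "\<And>h. h \<in> histories G \<sigma> \<Longrightarrow> length h \<le> q \<Longrightarrow> \<not> caught (last h) \<Longrightarrow>
      rule (fst (last h)) (snd (last h)) (\<sigma> h)"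
    and win: "\<And>h. h \<in> histories G \<sigma> \<Longrightarrow> length h = q + 1 \<Longrightarrow> caught (last h)"
    unfolding winning_strategy_def by blast
  have "cop_win G rule j (fst (last h)) (snd (last h))"
    \<comment> \<open>\<open>j\<close> is the number of rounds left, since after \<open>i\<close>
      rounds a history has length \<open>i + 1\<close>.\<close>
    if "h \<in> histories G \<sigma>" "length h + j = q + 1" for h j
    using that
  proof (induction j arbitrary: h)
    case 0
    then show ?case using win[of h] by (simp add: caught_def)
  next
    case (Suc j)
    show ?case
    proof (cases "caught (last h)")
      case True
      then show ?thesis by (simp add: caught_def)
    next
      case False
      have "cop_win G rule j (\<sigma> h) u" if "u \<in> esc G (\<sigma> h \<inter> fst (last h)) (snd (last h))" for u
        using Suc.IH[of "h @ [(\<sigma> h, u)]"] histories.round[OF Suc.prems(1) _ _ that] False Suc.prems(2)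
        by simp
      then show ?thesis using rule[OF Suc.prems(1) _ False] Suc.prems(2) by auto
    qed
  qed
  from this[OF histories.start] show "\<forall>v \<in> pverts G. cop_win G rule q {} v"
    by simp
next
  assume win: "\<forall>v \<in> pverts G. cop_win G rule q {} v"
  let ?P = "\<lambda>h Y. rule (fst (last h)) (snd (last h)) Y \<and>
    (\<forall>u \<in> esc G (Y \<inter> fst (last h)) (snd (last h)). cop_win G rule (q - length h) Y u)"
  define \<sigma> where "\<sigma> h = (SOME Y. ?P h Y)" for h
  have step: "?P h (\<sigma> h)"
    if len: "length h \<le> q" and nc: "\<not> caught (last h)"
      and w: "cop_win G rule (q + 1 - length h) (fst (last h)) (snd (last h))" for h
  proof -
    have "q + 1 - length h = Suc (q - length h)" using len by simp
    then have "\<exists>Y. ?P h Y" using w nc by (simp add: caught_def)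
    then show ?thesis unfolding \<sigma>_def by (rule someI_ex)
  qed
  have inv: "length h \<le> q + 1 \<and> cop_win G rule (q + 1 - length h) (fst (last h)) (snd (last h))"
    if "h \<in> histories G \<sigma>" for h
    using that
  proof induction
    case (start v)
    then show ?case using win by simp
  next
    case (round h X v u)
    have nc: "\<not> caught (last h)" using round by simp
    \<comment> \<open>At length \<open>q + 1\<close> no round is left, so winning means that Robber
      is caught; but caught histories are not continued.\<close>
    have "length h \<noteq> q + 1" using round.IH nc by (auto simp: caught_def)
    then have len: "length h \<le> q" using round.IH by simp
    from step[OF len nc] round.IH round.hyps show ?case using len by auto
  qed
  have "winning_strategy G rule q \<sigma>"
    unfolding winning_strategy_def
  proof (intro conjI ballI impI)
    fix h assume "h \<in> histories G \<sigma>" "length h \<le> q \<and> \<not> caught (last h)"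
    then show "rule (fst (last h)) (snd (last h)) (\<sigma> h)" using step inv by blast
  next
    fix h assume "h \<in> histories G \<sigma>" "length h = q + 1"
    then show "caught (last h)" using inv[of h] by (simp add: caught_def)
  qed
  then show "\<exists>\<sigma>. winning_strategy G rule q \<sigma>" by blast
qed

section \<open>Boundaries and components in a fixed graph\<close>

context pair_graph
begin

lemma nbhd_subset_verts: "nbhd G R \<subseteq> pverts G"
  by (auto simp: nbhd_def dest: in_arcsD2)

lemma finite_nbhd [simp]: "finite (nbhd G R)"
  using nbhd_subset_verts pair_finite_verts by (rule finite_subset)

lemma nbhd_verts: "nbhd G (pverts G) = {}"
  using nbhd_subset_verts nbhd_disjoint by fastforce

lemma nbhd_Int_empty_sym:
  assumes "nbhd G A \<inter> B = {}" "A \<inter> B = {}"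
  shows "nbhd G B \<inter> A = {}"
  using assms by (auto simp: nbhd_def dest: arcs_symmetric)

lemma nbhd_part:
  assumes "nbhd G A \<inter> B = {}"
  shows "nbhd G A \<subseteq> nbhd G (A \<union> B)"
  using assms by (auto simp: nbhd_def)

text \<open>\<open>rtrancl_on\<close> already confines a walk to \<open>pverts G - X\<close>, so
  inducing the subgraph first changes nothing. This form allows plain inductions over arcs of
  \<open>G\<close>.\<close>

lemma esc_conv: "v \<notin> X \<Longrightarrow> esc G X v = {u. (v, u) \<in> rtrancl_on (pverts G - X) (parcs G)}"
proof -
  have *: "rtrancl_on (pverts G - X) (arcs_ends (with_proj G \<restriction> (pverts G - X))) =
      rtrancl_on (pverts G - X) (parcs G)" (is "?A = ?B")
  proof (intro equalityI subrelI)
    fix a b assume "(a, b) \<in> ?A"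
    then show "(a, b) \<in> ?B"
      by (induction rule: rtrancl_on_induct) (auto simp: arcs_ends_conv intro: rtrancl_on_into_rtrancl_on)
  next
    fix a b assume "(a, b) \<in> ?B"
    then show "(a, b) \<in> ?A"
    proof (induction rule: rtrancl_on_induct)
      case (step y z)
      then have "(y, z) \<in> arcs_ends (with_proj G \<restriction> (pverts G - X))"
        by (force simp: arcs_ends_conv)
      with step show ?case by (auto intro: rtrancl_on_into_rtrancl_on)
    qed simp
  qed
  assume "v \<notin> X"
  then show ?thesis unfolding esc_def reachable_def by (simp add: *)
qed

lemma esc_caught: "v \<in> X \<Longrightarrow> esc G X v = {v}"
  by (simp add: esc_def)

lemma esc_self: "v \<in> pverts G \<Longrightarrow> v \<in> esc G X v"
  by (cases "v \<in> X") (auto simp: esc_conv esc_caught)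

lemma esc_subset: "v \<notin> X \<Longrightarrow> esc G X v \<subseteq> pverts G - X"
  by (auto simp: esc_conv dest: in_rtrancl_on_in_F)

lemma esc_in_verts: "v \<in> pverts G \<Longrightarrow> u \<in> esc G X v \<Longrightarrow> u \<in> pverts G"
  using esc_subset[of v X] by (cases "v \<in> X") (auto simp: esc_caught)

lemma nbhd_esc: "v \<notin> X \<Longrightarrow> nbhd G (esc G X v) \<subseteq> X"
  by (auto simp: nbhd_def esc_conv intro: rtrancl_on_into_rtrancl_on dest: in_arcsD2)

text \<open>A walk that avoids \<open>X\<close> cannot leave a set whose neighbours all lie in
  \<open>X\<close>. Together with \<open>nbhd_esc\<close> this characterises the escape space as a
  least set, and all later comparisons of escape spaces rest on it.\<close>

lemma esc_least:
  assumes "v \<in> P" "v \<notin> X" "nbhd G P \<subseteq> X"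
  shows "esc G X v \<subseteq> P"
proof
  fix u assume "u \<in> esc G X v"
  then have "(v, u) \<in> rtrancl_on (pverts G - X) (parcs G)" using assms(2) by (simp add: esc_conv)
  then show "u \<in> P"
    by (induction rule: rtrancl_on_induct) (use assms in \<open>auto simp: nbhd_def\<close>)
qed

section \<open>Uncrossing partial decompositions\<close>

text \<open>The competitors are only the sets between \<open>D\<close> and \<open>K\<close>:
  uncrossing compares \<open>K\<close> with its own part \<open>K \<inter> R\<close>.\<close>

definition tight :: "'a set \<Rightarrow> 'a set \<Rightarrow> bool" where
  "tight D K \<longleftrightarrow> D \<subseteq> K \<and> (\<forall>P. D \<subseteq> P \<and> P \<subseteq> K \<longrightarrow> card (nbhd G K) \<le> card (nbhd G P))"

text \<open>
  \<open>U\<close> is a bag or a union of bags, and \<open>R\<close> the part of \<open>G - U\<close> that contains \<open>D\<close>. The inequality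
  holds because \<open>K \<inter> R\<close> competes with \<open>K\<close> for the smallest neighbourhood.
\<close>

lemma card_uncross_le:
  assumes "tight D K" "D \<subseteq> R" "nbhd G R \<subseteq> U" "finite U"
  shows "card ((U - K) \<union> (nbhd G K - U - R)) \<le> card U"
proof -
  let ?S = "nbhd G K"
  \<comment> \<open>A neighbour of \<open>K \<inter> R\<close> outside \<open>K\<close> is in
    \<open>?S\<close>, and in \<open>R\<close> or its boundary. A neighbour inside \<open>K\<close>
    is outside \<open>R\<close>, hence in \<open>U\<close>.\<close>
  have "nbhd G (K \<inter> R) \<subseteq> (?S \<inter> (U \<union> R)) \<union> (U \<inter> K)"
    using assms(3) by (auto simp: nbhd_def)
  then have "card (nbhd G (K \<inter> R)) \<le> card (?S \<inter> (U \<union> R)) + card (U \<inter> K)"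
    by (meson assms(4) card_Un_le card_mono finite_Int finite_UnI finite_nbhd le_trans)
  moreover have "card ?S \<le> card (nbhd G (K \<inter> R))"
    using assms(1,2) by (auto simp: tight_def)
  moreover have "card ?S = card (?S \<inter> (U \<union> R)) + card (?S - U - R)"
    using card_Int_Diff[OF finite_nbhd, of K "U \<union> R"] by (simp add: Diff_eq Int_assoc)
  \<comment> \<open>The vertices to be added are paid for by those to be removed from
    \<open>U\<close>.\<close>
  ultimately have "card (?S - U - R) \<le> card (U \<inter> K)" by linarith
  moreover have "card U = card (U - K) + card (U \<inter> K)"
    using card_Int_Diff[OF assms(4), of K] by simp
  moreover have "card ((U - K) \<union> (?S - U - R)) \<le> card (U - K) + card (?S - U - R)"
    by (rule card_Un_le)
  ultimately show ?thesis by linarith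
qed

text \<open>An inclusion instead of an equality, because rebuilding the decomposition cuts pieces
  off the leaves. All of \<open>D\<close> refers to a single Cop position \<open>Y\<close>.\<close>

definition trapped :: "nat \<Rightarrow> nat \<Rightarrow> 'a set \<Rightarrow> bool" where
  "trapped k j D \<longleftrightarrow>
     (\<exists>Y v. v \<in> pverts G \<and> v \<notin> Y \<and> cop_win G (CR_rule G k) j Y v \<and> D \<subseteq> esc G Y v)"

lemma trapped_subset: "trapped k j D \<Longrightarrow> E \<subseteq> D \<Longrightarrow> trapped k j E"
  by (auto simp: trapped_def)

text \<open>
  In \<open>partial_dec k q i n U R\<close> the region \<open>R\<close> is still to be decomposed, \<open>U\<close> is the union of the
  bags on the branch so far, and \<open>n\<close> counts the open leaves, those with \<open>i + 1\<close> rounds left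
  instead of \<open>i\<close>.
\<close>

inductive partial_dec :: "nat \<Rightarrow> nat \<Rightarrow> nat \<Rightarrow> nat \<Rightarrow> 'a set \<Rightarrow> 'a set \<Rightarrow> bool" for k q i where
  empty: "partial_dec k q i 0 U {}"
| leaf: "\<lbrakk>trapped k i D; card U + i \<le> q\<rbrakk> \<Longrightarrow> partial_dec k q i 0 U D"
| open_leaf: "\<lbrakk>trapped k (Suc i) D; card U + Suc i \<le> q\<rbrakk> \<Longrightarrow> partial_dec k q i 1 U D"
| split: "\<lbrakk>partial_dec k q i m U R; partial_dec k q i n U R'; R \<inter> R' = {}; nbhd G R \<inter> R' = {}\<rbrakk>
    \<Longrightarrow> partial_dec k q i (m + n) U (R \<union> R')"
| bag: "\<lbrakk>nbhd G R \<subseteq> X; X \<subseteq> U \<union> R; card X \<le> k; card (U \<union> X) \<le> q; partial_dec k q i n (U \<union> X) (R - X)\<rbrakk>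
    \<Longrightarrow> partial_dec k q i n U R"

text \<open>This rebuilds a branch that leads away from the leaf \<open>D\<close>. The set
  \<open>M\<close> is the side of \<open>D\<close>: its boundary lies in \<open>U\<close>, so
  \<open>card_uncross_le\<close> applied to \<open>M\<close> shows that the union of bags along the
  branch does not grow. Leaves only shrink and stay trapped.\<close>

lemma partial_dec_outside:
  assumes "partial_dec k q i n U R"
    and "tight D K" "D \<subseteq> M" "nbhd G M \<subseteq> U" "M \<inter> (U \<union> R) = {}"
    and "nbhd G R \<subseteq> U" "R \<inter> U = {}" "finite U" "R \<subseteq> pverts G"
  shows "partial_dec k q i n ((U - K) \<union> (nbhd G K - U - M)) (R - (K \<union> nbhd G K))"
  using assms
proof (induction rule: partial_dec.induct)
  case (empty U)
  then show ?case by (simp add: partial_dec.empty)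
next
  case (leaf E U)
  then show ?case using card_uncross_le[of D K M U] trapped_subset[OF leaf.hyps(1)]
    by (intro partial_dec.leaf) auto
next
  case (open_leaf E U)
  then show ?case using card_uncross_le[of D K M U] trapped_subset[OF open_leaf.hyps(1)]
    by (intro partial_dec.open_leaf) auto
next
  case (split m U R n R')
  have "nbhd G R' \<inter> R = {}" using split.hyps nbhd_Int_empty_sym by blast
  then have "nbhd G R \<subseteq> U" "nbhd G R' \<subseteq> U"
    using split.prems(5) nbhd_part[of R R'] nbhd_part[of R' R] split.hyps by (auto simp: Un_commute)
  then have "partial_dec k q i m ((U - K) \<union> (nbhd G K - U - M)) (R - (K \<union> nbhd G K))"
    "partial_dec k q i n ((U - K) \<union> (nbhd G K - U - M)) (R' - (K \<union> nbhd G K))"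
    using split.IH split.prems by blast+
  moreover have "nbhd G (R - (K \<union> nbhd G K)) \<inter> (R' - (K \<union> nbhd G K)) = {}"
    using split.hyps by (auto simp: nbhd_def)
  ultimately have "partial_dec k q i (m + n) ((U - K) \<union> (nbhd G K - U - M))
      ((R - (K \<union> nbhd G K)) \<union> (R' - (K \<union> nbhd G K)))"
    using split.hyps by (intro partial_dec.split) auto
  then show ?case by (simp add: Un_Diff)
next
  case (bag R X U n)
  let ?S = "nbhd G K"
  let ?U = "(U - K) \<union> (?S - U - M)"
  \<comment> \<open>Seen from the bag \<open>X\<close>, the leaf lies in the complement of
    \<open>R \<union> X\<close>. Uncrossing with \<open>?O\<close> bounds the new bag, uncrossing
    with \<open>M\<close> the new union.\<close>
  let ?O = "- R - X"
  have X: "finite X" using bag.hyps(2) bag.prems pair_finite_verts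
    by (meson finite_UnI finite_subset)
  have DO: "D \<subseteq> ?O" using bag by auto
  have SK: "?S \<inter> K = {}" by (rule nbhd_disjoint)
  have "nbhd G ?O \<subseteq> X"
    using bag.hyps(1) by (auto simp: nbhd_def dest: arcs_symmetric)
  from card_uncross_le[OF bag.prems(1) DO this X]
  have "card ((X - K) \<union> (?S - X - ?O)) \<le> card X" .
  moreover have eqX: "(X - K) \<union> (?S - X - ?O) = (X - K) \<union> (?S \<inter> R)" using SK by blast
  ultimately have c: "card ((X - K) \<union> (?S \<inter> R)) \<le> k" using bag.hyps(3) by simp
  have M: "nbhd G M \<subseteq> U \<union> X" "M \<inter> ((U \<union> X) \<union> (R - X)) = {}" using bag by auto
  have IH: "partial_dec k q i n (((U \<union> X) - K) \<union> (?S - (U \<union> X) - M)) (R - X - (K \<union> ?S))"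
  proof (rule bag.IH)
    show "nbhd G (R - X) \<subseteq> U \<union> X" using bag.prems(5) nbhd_Diff_subset[of G R X] by blast
  qed (use bag M X in auto)
  have eqU: "((U \<union> X) - K) \<union> (?S - (U \<union> X) - M) = ?U \<union> ((X - K) \<union> (?S \<inter> R))"
    using bag.hyps(2) bag.prems(4) SK by blast
  have eqR: "R - X - (K \<union> ?S) = (R - (K \<union> ?S)) - ((X - K) \<union> (?S \<inter> R))" by blast
  have "card (((U \<union> X) - K) \<union> (?S - (U \<union> X) - M)) \<le> card (U \<union> X)"
    using card_uncross_le[OF bag.prems(1,2) M(1)] X bag.prems by auto
  then have c2: "card (?U \<union> ((X - K) \<union> (?S \<inter> R))) \<le> q" using bag.hyps(4) eqU by simp
  show ?case
  proof (rule partial_dec.bag[OF _ _ c c2])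
    show "nbhd G (R - (K \<union> ?S)) \<subseteq> (X - K) \<union> (?S \<inter> R)"
      using bag.hyps(1) arcs_symmetric unfolding nbhd_def by blast
    show "(X - K) \<union> (?S \<inter> R) \<subseteq> ?U \<union> (R - (K \<union> ?S))"
      using bag.hyps(2) bag.prems by blast
    show "partial_dec k q i n (?U \<union> ((X - K) \<union> (?S \<inter> R))) (R - (K \<union> ?S) - ((X - K) \<union> (?S \<inter> R)))"
      using IH eqU eqR by simp
  qed
qed

text \<open>All admissible \<open>U\<close> are quantified over because the branch above the leaf is
  itself rebuilt depending on \<open>K\<close>. The room for \<open>i + 1\<close> is what an open
  leaf has; the resulting leaves have \<open>i\<close> rounds left.\<close>

definition closable :: "nat \<Rightarrow> nat \<Rightarrow> nat \<Rightarrow> 'a set \<Rightarrow> bool" where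
  "closable k q i K \<longleftrightarrow> (\<forall>U. finite U \<and> nbhd G K \<subseteq> U \<and> U \<inter> K = {} \<and> card U + Suc i \<le> q \<longrightarrow>
     partial_dec k q i 0 U K)"

text \<open>The part \<open>R\<close> containing \<open>D\<close> needs the vertices of
  \<open>nbhd G K\<close> in \<open>R'\<close> on its branch, while the region above the split does
  not supply them. An additional bag, the uncrossed boundary of \<open>R \<union> R'\<close>, is put
  above the split to introduce them. Its size is controlled by the bound \<open>k\<close> on that
  boundary.\<close>

lemma partial_dec_split_inside:
  assumes "partial_dec k q i m ((U - K) \<union> (nbhd G K - U - R)) (R \<union> K)"
    and "partial_dec k q i n U R'"
    and "R \<inter> R' = {}" "nbhd G R \<inter> R' = {}"
    and "tight D K" "D \<subseteq> R"
    and "nbhd G (R \<union> R') \<subseteq> U" "(R \<union> R') \<inter> U = {}" "finite U" "card U \<le> q"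
    and "card (nbhd G (R \<union> R')) \<le> k" "R \<union> R' \<subseteq> pverts G"
  shows "partial_dec k q i (m + n) ((U - K) \<union> (nbhd G K - U - (R \<union> R'))) (R \<union> R' \<union> K)"
proof -
  let ?S = "nbhd G K"
  let ?U = "(U - K) \<union> (?S - U - (R \<union> R'))"
  let ?B = "nbhd G (R \<union> R')"
  let ?X = "(?B - K) \<union> (?S - ?B - R)"
  let ?U1 = "(U - K) \<union> (?S - U - R)"
  have SK: "?S \<inter> K = {}" by (rule nbhd_disjoint)
  have BR: "?B \<inter> (R \<union> R') = {}" by (rule nbhd_disjoint)
  have R: "nbhd G R \<subseteq> ?B" using assms(4) by (rule nbhd_part)
  have "nbhd G R' \<inter> R = {}" using assms nbhd_Int_empty_sym by blast
  from nbhd_part[OF this] have R': "nbhd G R' \<subseteq> ?B" by (simp add: Un_commute)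
  have c: "card ?X \<le> k" using card_uncross_le[OF assms(5,6) R] assms(11) by simp
  \<comment> \<open>With the new bag, the branch is exactly the one for which both parts have been
    rebuilt.\<close>
  have eqU: "?U \<union> ?X = ?U1" using SK assms(3,7,8) by blast
  have eqR: "(R \<union> R' \<union> K) - ?X = (R \<union> K) \<union> (R' - (K \<union> ?S))" using SK BR assms(3) by blast
  have out: "partial_dec k q i n ?U1 (R' - (K \<union> ?S))"
    by (rule partial_dec_outside[OF assms(2,5,6)]) (use assms R R' in auto)
  have "partial_dec k q i (m + n) ?U1 ((R \<union> K) \<union> (R' - (K \<union> ?S)))"
  proof (rule partial_dec.split[OF assms(1) out])
    show "(R \<union> K) \<inter> (R' - (K \<union> ?S)) = {}" using assms(3) by blast
    show "nbhd G (R \<union> K) \<inter> (R' - (K \<union> ?S)) = {}"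
      using assms(3,4) unfolding nbhd_def by blast
  qed
  moreover have "card ?U1 \<le> q"
    using card_uncross_le[OF assms(5,6) _ assms(9)] R assms(7,10) by (meson order_trans)
  ultimately have dec: "partial_dec k q i (m + n) (?U \<union> ?X) ((R \<union> R' \<union> K) - ?X)"
    and cU: "card (?U \<union> ?X) \<le> q"
    by (simp_all only: eqU eqR)
  show ?thesis
  proof (rule partial_dec.bag[OF _ _ c cU dec])
    show "nbhd G (R \<union> R' \<union> K) \<subseteq> ?X" unfolding nbhd_def by blast
    show "?X \<subseteq> ?U \<union> (R \<union> R' \<union> K)" using assms(7) by blast
  qed
qed

text \<open>The leaf \<open>D\<close> is found first and \<open>K\<close> is chosen for it
  afterwards, whence the order of quantifiers. Since \<open>K\<close> may reach beyond
  \<open>R\<close>, the rebuilt region is \<open>R \<union> K\<close>. The bound on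
  \<open>nbhd G R\<close> is inherited from the bag above and feeds the extra bag at splits.\<close>

lemma partial_dec_close_leaf:
  assumes "partial_dec k q i m U R" "m = Suc n"
    and "nbhd G R \<subseteq> U" "R \<inter> U = {}" "finite U" "card U \<le> q"
    and "card (nbhd G R) \<le> k" "R \<subseteq> pverts G"
  shows "\<exists>D \<subseteq> R. trapped k (Suc i) D \<and> (\<forall>K. tight D K \<longrightarrow> closable k q i K \<longrightarrow>
    partial_dec k q i n ((U - K) \<union> (nbhd G K - U - R)) (R \<union> K))"
  using assms
proof (induction arbitrary: n rule: partial_dec.induct)
  case (open_leaf D U)
  have "partial_dec k q i 0 ((U - K) \<union> (nbhd G K - U - D)) (D \<union> K)"
    if t: "tight D K" and c: "closable k q i K" for K
  proof -
    let ?U = "(U - K) \<union> (nbhd G K - U - D)"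
    have DK: "D \<subseteq> K" using t by (simp add: tight_def)
    \<comment> \<open>Uncrossing at the leaf itself leaves the room that \<open>closable\<close>
      asks for.\<close>
    have "card ?U \<le> card U" using card_uncross_le[OF t _ open_leaf.prems(2,4)] by simp
    then have "partial_dec k q i 0 ?U K"
      using DK nbhd_disjoint[of G K] open_leaf.prems(3,4) open_leaf.hyps(2)
      by (intro c[unfolded closable_def, THEN spec, THEN mp]) auto
    then show ?thesis using DK by (simp add: Un_absorb1)
  qed
  then show ?case using open_leaf by auto
next
  case (split m U R n' R')
  note hyps = split.hyps
  have sym: "nbhd G R' \<inter> R = {}" using hyps nbhd_Int_empty_sym by blast
  have NR: "nbhd G R \<subseteq> nbhd G (R \<union> R')" using hyps(4) by (rule nbhd_part)
  have NR': "nbhd G R' \<subseteq> nbhd G (R \<union> R')" using nbhd_part[OF sym] by (simp add: Un_commute)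
  have cR: "card (nbhd G R) \<le> k" "card (nbhd G R') \<le> k"
    using NR NR' split.prems(6) by (meson card_mono finite_nbhd le_trans)+
  show ?case
  proof (cases m)
    case (Suc m')
    have "nbhd G R \<subseteq> U" "R \<inter> U = {}" "R \<subseteq> pverts G" using split.prems NR by auto
    with split.IH(1)[OF Suc _ _ split.prems(4,5) cR(1)] obtain D where
      D: "D \<subseteq> R" "trapped k (Suc i) D"
      and *: "\<And>K. tight D K \<Longrightarrow> closable k q i K \<Longrightarrow>
         partial_dec k q i m' ((U - K) \<union> (nbhd G K - U - R)) (R \<union> K)"
      by blast
    have "partial_dec k q i (m' + n') ((U - K) \<union> (nbhd G K - U - (R \<union> R'))) (R \<union> R' \<union> K)"
      if "tight D K" "closable k q i K" for K
      by (rule partial_dec_split_inside[OF *[OF that] hyps(2,3,4) that(1) D(1)])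
         (use split.prems in auto)
    moreover have "n = m' + n'" using Suc split.prems(1) by simp
    ultimately show ?thesis using D by blast
  next
    case 0
    \<comment> \<open>The first part has no open leaf, so one is taken from the second and the roles
      of the parts are exchanged.\<close>
    then have n': "n' = Suc n" using split.prems(1) by simp
    have "nbhd G R' \<subseteq> U" "R' \<inter> U = {}" "R' \<subseteq> pverts G" using split.prems NR' by auto
    with split.IH(2)[OF n' _ _ split.prems(4,5) cR(2)] obtain D where
      D: "D \<subseteq> R'" "trapped k (Suc i) D"
      and *: "\<And>K. tight D K \<Longrightarrow> closable k q i K \<Longrightarrow>
         partial_dec k q i n ((U - K) \<union> (nbhd G K - U - R')) (R' \<union> K)"
      by blast
    have "partial_dec k q i (n + 0) ((U - K) \<union> (nbhd G K - U - (R' \<union> R))) (R' \<union> R \<union> K)"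
      if "tight D K" "closable k q i K" for K
      by (rule partial_dec_split_inside[OF *[OF that] _ _ sym that(1) D(1)])
         (use split.prems hyps 0 in \<open>auto simp: Un_commute\<close>)
    then show ?thesis using D by (auto simp: Un_commute)
  qed
next
  case (bag R X U n')
  have X: "finite X" using bag.hyps(2) bag.prems pair_finite_verts
    by (meson finite_UnI finite_subset)
  have NX: "nbhd G (R - X) \<subseteq> X" using bag.hyps(1) nbhd_Diff_subset[of G R X] by blast
  then have "card (nbhd G (R - X)) \<le> k" using X bag.hyps(3) by (meson card_mono le_trans)
  moreover have "nbhd G (R - X) \<subseteq> U \<union> X" "(R - X) \<inter> (U \<union> X) = {}" "finite (U \<union> X)"
    "R - X \<subseteq> pverts G"
    using NX X bag.prems by auto
  ultimately obtain D where
    D: "D \<subseteq> R - X" "trapped k (Suc i) D"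
    and *: "\<And>K. tight D K \<Longrightarrow> closable k q i K \<Longrightarrow>
      partial_dec k q i n (((U \<union> X) - K) \<union> (nbhd G K - (U \<union> X) - (R - X))) ((R - X) \<union> K)"
    using bag.IH[OF bag.prems(1)] bag.hyps(4) by blast
  have "partial_dec k q i n ((U - K) \<union> (nbhd G K - U - R)) (R \<union> K)"
    if t: "tight D K" and c: "closable k q i K" for K
  proof -
    let ?S = "nbhd G K"
    let ?U = "(U - K) \<union> (?S - U - R)"
    \<comment> \<open>The leaf lies below the bag, in \<open>R - X\<close>; the vertices of
      \<open>?S\<close> that \<open>X\<close> separates from it replace
      \<open>X \<inter> K\<close>.\<close>
    let ?X = "(X - K) \<union> (?S - X - (R - X))"
    have SK: "?S \<inter> K = {}" by (rule nbhd_disjoint)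
    have cX: "card ?X \<le> k" using card_uncross_le[OF t D(1) NX X] bag.hyps(3) by simp
    have eqU: "((U \<union> X) - K) \<union> (?S - (U \<union> X) - (R - X)) = ?U \<union> ?X" using SK by blast
    have eqR: "(R - X) \<union> K = (R \<union> K) - ?X" using SK by blast
    have "card (?U \<union> ?X) \<le> card (U \<union> X)"
      unfolding eqU[symmetric] using NX X bag.prems by (intro card_uncross_le[OF t D(1)]) auto
    then have cU: "card (?U \<union> ?X) \<le> q" using bag.hyps(4) by simp
    show ?thesis
    proof (rule partial_dec.bag[OF _ _ cX cU])
      show "nbhd G (R \<union> K) \<subseteq> ?X" using bag.hyps(1) unfolding nbhd_def by blast
      show "?X \<subseteq> ?U \<union> (R \<union> K)" using bag.hyps(2) by blast
      show "partial_dec k q i n (?U \<union> ?X) (R \<union> K - ?X)"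
        using *[OF t c] unfolding eqU eqR .
    qed
  qed
  then show ?case using D by blast
qed simp_all

text \<open>The region avoids \<open>Y\<close>, so it falls apart along the components of
  \<open>G - Y\<close>. Each component that it meets yields one leaf, and different leaves may be
  won by different continuations.\<close>

lemma partial_dec_trapped:
  assumes "R \<subseteq> pverts G" "card U + i \<le> q"
    and "\<And>v. v \<in> R \<Longrightarrow> v \<notin> Y \<and> cop_win G (CR_rule G k) i Y v"
  shows "partial_dec k q i 0 U R"
proof -
  have "finite R" using assms(1) pair_finite_verts by (rule finite_subset)
  then show ?thesis using assms(1,3)
  proof (induction rule: finite_psubset_induct)
    case (psubset R)
    show ?case
    proof (cases "R = {}")
      case False
      then obtain u where u: "u \<in> R" by blast
      let ?A = "esc G Y u"
      have uY: "u \<notin> Y" "u \<in> pverts G" using u psubset.prems by auto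
      then have "trapped k i (R \<inter> ?A)" using psubset.prems u unfolding trapped_def by blast
      then have 1: "partial_dec k q i 0 U (R \<inter> ?A)" using assms(2) by (rule partial_dec.leaf)
      have "R - ?A \<subset> R" using u uY esc_self by blast
      then have 2: "partial_dec k q i 0 U (R - ?A)" using psubset.prems by (intro psubset.IH) auto
      have "partial_dec k q i (0 + 0) U ((R \<inter> ?A) \<union> (R - ?A))"
      proof (rule partial_dec.split[OF 1 2])
        show "nbhd G (R \<inter> ?A) \<inter> (R - ?A) = {}"
          using nbhd_esc[OF uY(1)] psubset.prems(2) unfolding nbhd_def by blast
      qed blast
      then show ?thesis by (simp add: Int_Diff_Un)
    qed (simp add: partial_dec.empty)
  qed
qed

text \<open>\<open>K\<close> minimises the boundary among all sets between \<open>D\<close> and the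
  space \<open>?C\<close> that Robber has during Cop's next move. Minimality makes room in one bag
  for the boundary of \<open>K\<close> and the new cop.\<close>

lemma trapped_imp_closable:
  assumes "trapped k (Suc i) D"
  obtains K where "tight D K" "closable k q i K" "K \<subseteq> pverts G"
proof -
  from assms obtain Y v where v: "v \<in> pverts G" "v \<notin> Y" and D: "D \<subseteq> esc G Y v"
    and "cop_win G (CR_rule G k) (Suc i) Y v" by (auto simp: trapped_def)
  then obtain Y' where Y': "CR_rule G k Y v Y'"
    and win: "\<And>u. u \<in> esc G (Y' \<inter> Y) v \<Longrightarrow> cop_win G (CR_rule G k) i Y' u" by auto
  let ?Z = "Y' \<inter> Y"
  let ?C = "esc G ?Z v"
  have vZ: "v \<notin> ?Z" using v by blast
  have C: "nbhd G ?C \<subseteq> ?Z" "?C \<subseteq> pverts G - ?Z" by (rule nbhd_esc[OF vZ], rule esc_subset[OF vZ])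
  \<comment> \<open>Lifting cops can only enlarge Robber's space, so \<open>D\<close> stays inside
    it.\<close>
  have "esc G Y v \<subseteq> ?C"
    using esc_self[OF v(1), of ?Z] v(2) subset_trans[OF C(1) Int_lower2] by (rule esc_least)
  then have DC: "D \<subseteq> ?C" using D by simp
  define \<K> where "\<K> = {P. D \<subseteq> P \<and> P \<subseteq> ?C}"
  have "?C \<in> \<K>" using DC by (simp add: \<K>_def)
  then obtain K where "K \<in> \<K>" and leastK: "\<And>P. P \<in> \<K> \<Longrightarrow> card (nbhd G K) \<le> card (nbhd G P)"
    using ex_has_least_nat[of "\<lambda>P. P \<in> \<K>" ?C "\<lambda>P. card (nbhd G P)"] by auto
  then have K: "D \<subseteq> K" "K \<subseteq> ?C" by (simp_all add: \<K>_def)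
  have least: "card (nbhd G K) \<le> card (nbhd G P)" if "D \<subseteq> P" "P \<subseteq> ?C" for P
    using leastK that by (simp add: \<K>_def)
  have "tight D K" using K least unfolding tight_def by blast
  moreover have "closable k q i K"
    unfolding closable_def
  proof (intro allI impI, elim conjE)
    fix U assume U: "finite U" "nbhd G K \<subseteq> U" "U \<inter> K = {}" "card U + Suc i \<le> q"
    let ?X = "nbhd G K \<union> (Y' \<inter> K)"
    have fY': "finite Y'" using Y' pair_finite_verts finite_subset unfolding CR_rule_def by blast
    \<comment> \<open>\<open>K\<close> lies in \<open>?C\<close> and thus avoids
      \<open>Y' \<inter> Y\<close>: only a newly placed cop can be in \<open>K\<close>.\<close>
    have new: "Y' \<inter> K \<subseteq> Y' - Y" using K C by blast
    have one: "card (Y' \<inter> K) \<le> card (Y' - Y)" using new fY' by (intro card_mono) auto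
    have "card (nbhd G K) \<le> card (nbhd G ?C)" using K least by blast
    also have "\<dots> \<le> card ?Z" using C fY' by (intro card_mono) auto
    finally have "card ?X \<le> card ?Z + card (Y' - Y)"
      using one card_Un_le[of "nbhd G K" "Y' \<inter> K"] by linarith
    also have "\<dots> = card Y'" using card_Int_Diff[OF fY', of Y] by simp
    finally have X: "card ?X \<le> k" using Y' by (simp add: CR_rule_def)
    \<comment> \<open>The boundary of \<open>K\<close> is already on the branch, so the bag adds at
      most one vertex to it, paid for by the round.\<close>
    have eq: "U \<union> ?X = U \<union> (Y' \<inter> K)" using U(2) by blast
    have UX: "card (U \<union> ?X) \<le> card U + 1"
      unfolding eq using card_Un_le[of U "Y' \<inter> K"] one Y' by (simp add: CR_rule_def)
    have "partial_dec k q i 0 (U \<union> ?X) (K - ?X)"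
    proof (rule partial_dec_trapped[where Y = Y'])
      show "K - ?X \<subseteq> pverts G" using K C by blast
      show "card (U \<union> ?X) + i \<le> q" using UX U(4) by linarith
      show "u \<notin> Y' \<and> cop_win G (CR_rule G k) i Y' u" if "u \<in> K - ?X" for u
        using that K win by blast
    qed
    moreover have "card (U \<union> ?X) \<le> q" using UX U(4) by linarith
    moreover have "?X \<subseteq> U \<union> K" using U(2) by blast
    ultimately show "partial_dec k q i 0 U K"
      using partial_dec.bag[OF Un_upper1 _ X] by blast
  qed
  moreover have "K \<subseteq> pverts G" using K C by blast
  ultimately show thesis by (rule that)
qed

section \<open>Using up the rounds level by level\<close>

lemma partial_dec_close_all:
  "partial_dec k q i n {} (pverts G) \<Longrightarrow> partial_dec k q i 0 {} (pverts G)"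
proof (induction n)
  case (Suc n)
  from partial_dec_close_leaf[OF Suc.prems refl] obtain D where D: "trapped k (Suc i) D"
    and *: "\<And>K. tight D K \<Longrightarrow> closable k q i K \<Longrightarrow>
      partial_dec k q i n (({} - K) \<union> (nbhd G K - {} - pverts G)) (pverts G \<union> K)"
    by (auto simp: nbhd_verts)
  from trapped_imp_closable[OF D, of q] obtain K where
    K: "tight D K" "closable k q i K" "K \<subseteq> pverts G" .
  \<comment> \<open>At the root nothing lies outside the region, so rebuilding changes neither the
    region nor the empty branch.\<close>
  have "nbhd G K - pverts G = {}" using nbhd_subset_verts by blast
  then have "partial_dec k q i n {} (pverts G)" using *[OF K(1,2)] K(3)
    by (simp only: Un_absorb2 empty_Diff Diff_empty Un_empty_left)
  then show ?case by (rule Suc.IH)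
qed

text \<open>Without open leaves, every leaf has \<open>i + 1\<close> rounds left; one level lower
  these same leaves count as open.\<close>

lemma partial_dec_level:
  assumes "partial_dec k q (Suc i) m U R" "m = 0"
  shows "\<exists>n. partial_dec k q i n U R"
  using assms
proof (induction rule: partial_dec.induct)
  case (leaf D U)
  then show ?case using partial_dec.open_leaf by blast
next
  case (split m U R n R')
  then obtain m' n' where "partial_dec k q i m' U R" "partial_dec k q i n' U R'" by auto
  from partial_dec.split[OF this split.hyps(3,4)] show ?case by blast
next
  case (bag R X U n)
  then obtain n' where "partial_dec k q i n' (U \<union> X) (R - X)" by auto
  from partial_dec.bag[OF bag.hyps(1-4) this] show ?case by blast
next
  case (empty U)
  show ?case using partial_dec.empty by blast
qed simp

lemma partial_dec_level_zero:
  "partial_dec k q i 0 {} (pverts G) \<Longrightarrow> partial_dec k q 0 0 {} (pverts G)"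
proof (induction i)
  case (Suc i)
  then show ?case using partial_dec_level partial_dec_close_all by blast
qed

section \<open>Elimination and the monotone game\<close>

text \<open>An elimination scheme of height at most \<open>j\<close> that removes single vertices,
  each time from a region with fewer than \<open>k\<close> boundary vertices. It mediates between
  decompositions, the monotone game and forest covers.\<close>

inductive elim_dec :: "nat \<Rightarrow> nat \<Rightarrow> 'a set \<Rightarrow> bool" for k where
  empty: "elim_dec k j {}"
| split: "\<lbrakk>elim_dec k j R; elim_dec k j R'; R \<inter> R' = {}; nbhd G R \<inter> R' = {}\<rbrakk>
    \<Longrightarrow> elim_dec k j (R \<union> R')"
| vertex: "\<lbrakk>v \<in> R; card (nbhd G R) < k; elim_dec k j (R - {v})\<rbrakk> \<Longrightarrow> elim_dec k (Suc j) R"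

text \<open>A bag is eliminated vertex by vertex. Boundaries met on the way stay inside
  \<open>nbhd G R \<union> A\<close>.\<close>

lemma elim_dec_Diff:
  assumes "finite A" "A \<subseteq> R" "elim_dec k j (R - A)" "card (nbhd G R \<union> A) \<le> k"
  shows "elim_dec k (j + card A) R"
  using assms
proof (induction A arbitrary: R rule: finite_induct)
  case (insert a A)
  have aR: "a \<in> R" using insert.prems by blast
  have "card (nbhd G (R - {a}) \<union> A) \<le> card (nbhd G R \<union> insert a A)"
    using nbhd_Diff_subset[of G R "{a}"] insert.hyps(1) by (intro card_mono) auto
  moreover have "R - {a} - A = R - insert a A" by blast
  ultimately have "elim_dec k (j + card A) (R - {a})"
    using insert by (intro insert.IH) auto
  moreover have "card (nbhd G R) < k"
  proof -
    \<comment> \<open>The vertex \<open>a\<close> is in the bag but not in the boundary, which gives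
      the strict bound.\<close>
    have "nbhd G R \<subset> nbhd G R \<union> insert a A" using nbhd_disjoint[of G R] aR by blast
    then show ?thesis using insert.prems(3) insert.hyps(1)
      by (meson finite.insertI finite_UnI finite_nbhd less_le_trans psubset_card_mono)
  qed
  ultimately show ?case using aR insert.hyps by (simp add: elim_dec.vertex)
qed simp

text \<open>With no round left a leaf is impossible: winning would put \<open>v\<close> in
  \<open>Y\<close>, but trapped means \<open>v \<notin> Y\<close>. Only bags and splits remain, and
  a bag costs as many removals as it adds vertices to the branch.\<close>

lemma partial_dec_imp_elim_dec:
  assumes "partial_dec k q i n U R" "i = 0" "n = 0"
    and "U \<inter> R = {}" "finite U" "R \<subseteq> pverts G" "card U \<le> q"
  shows "elim_dec k (q - card U) R"
  using assms
proof (induction rule: partial_dec.induct)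
  case (bag R X U n)
  have X: "finite X" using bag.hyps(2) bag.prems pair_finite_verts
    by (meson finite_UnI finite_subset)
  have "card (U \<union> X) = card (U \<union> (X \<inter> R))"
    using bag.hyps(2) by (intro arg_cong[of _ _ card]) blast
  also have "\<dots> = card U + card (X \<inter> R)"
    using X bag.prems by (intro card_Un_disjoint) auto
  finally have c: "card (U \<union> X) = card U + card (X \<inter> R)" .
  have "elim_dec k (q - card (U \<union> X)) (R - X)" using bag X by auto
  moreover have "R - X = R - X \<inter> R" by blast
  moreover have "card (nbhd G R \<union> X \<inter> R) \<le> k"
    using bag.hyps(1,3) X by (meson Int_lower1 Un_least card_mono le_trans)
  ultimately have "elim_dec k (q - card (U \<union> X) + card (X \<inter> R)) R"
    using X by (intro elim_dec_Diff) auto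
  then show ?case using c bag.hyps(4) by simp
next
  case (split m U R n R')
  then show ?case by (auto intro!: elim_dec.split)
qed (auto simp: trapped_def intro: elim_dec.empty)

lemma cop_win_Suc: "cop_win G rule j X v \<Longrightarrow> cop_win G rule (Suc j) X v"
proof (induction j arbitrary: X v)
  case (Suc j)
  then show ?case by (metis cop_win.simps(2))
qed simp

text \<open>Cop keeps only the cops on the boundary of Robber's component and adds one on the vertex
  to be eliminated. The invariant that this boundary avoids \<open>R\<close> places it inside
  \<open>nbhd G R\<close>, which bounds the number of cops.\<close>

lemma elim_dec_imp_cop_win_mon:
  assumes "elim_dec k j R" "R \<subseteq> pverts G" "v \<in> pverts G" "v \<notin> X"
    and "esc G X v \<subseteq> R" "nbhd G (esc G X v) \<inter> R = {}"
  shows "cop_win G (monCR_rule G k) j X v"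
  using assms
proof (induction arbitrary: X v rule: elim_dec.induct)
  case (empty j)
  then show ?case using esc_self by blast
next
  case (split j R R')
  let ?C = "esc G X v"
  have sym: "nbhd G R' \<inter> R = {}" using split.hyps nbhd_Int_empty_sym by blast
  \<comment> \<open>As a component, \<open>?C\<close> cannot meet both sides of a split.\<close>
  have *: "?C \<subseteq> A" if "v \<in> A" "nbhd G A \<inter> B = {}" "?C \<subseteq> A \<union> B" for A B
  proof -
    have "nbhd G (?C \<inter> A) \<subseteq> X"
      using that nbhd_esc[OF split.prems(3)] unfolding nbhd_def by blast
    then show ?thesis using esc_least[of v "?C \<inter> A" X] that split.prems esc_self by blast
  qed
  have "v \<in> R \<union> R'" using split.prems esc_self by blast
  then show ?case
  proof
    assume "v \<in> R"
    from *[OF this split.hyps(4)] show ?thesis using split.prems by (intro split.IH(1)) auto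
  next
    assume "v \<in> R'"
    from *[OF this sym] show ?thesis using split.prems by (intro split.IH(2)) auto
  qed
next
  case (vertex y R j)
  let ?C = "esc G X v"
  show ?case
  proof (cases "y \<in> ?C")
    case False
    \<comment> \<open>The vertex \<open>y\<close> is not in Robber's component, so the elimination
      step takes no round.\<close>
    then show ?thesis using vertex.prems by (intro cop_win_Suc vertex.IH) auto
  next
    case True
    let ?N = "nbhd G ?C"
    let ?Y = "insert y ?N"
    have N: "?N \<subseteq> X" and C: "?C \<subseteq> pverts G - X" and vC: "v \<in> ?C"
      by (rule nbhd_esc[OF vertex.prems(3)], rule esc_subset[OF vertex.prems(3)],
          rule esc_self[OF vertex.prems(2)])
    have yX: "y \<notin> X" using C True by blast
    have YX: "?Y \<inter> X = ?N" using N yX by blast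
    have "?N \<subseteq> nbhd G R" using vertex.prems(4,5) unfolding nbhd_def by blast
    then have "card ?N < k" using vertex.hyps(2) by (meson card_mono finite_nbhd le_less_trans)
    then have "card ?Y \<le> k" by (simp add: card_insert_if)
    moreover have "card (?Y - X) \<le> 1"
    proof -
      have "?Y - X \<subseteq> {y}" using N by blast
      then have "card (?Y - X) \<le> card {y}" by (rule card_mono[rotated]) simp
      then show ?thesis by simp
    qed
    \<comment> \<open>The boundary alone confines Robber, so lifting all other cops is
      monotone.\<close>
    moreover have escN: "esc G ?N v = ?C"
    proof
      have vN: "v \<notin> ?N" using vC by (simp add: nbhd_def)
      show "esc G ?N v \<subseteq> ?C" using vC vN subset_refl by (rule esc_least)
      show "?C \<subseteq> esc G ?N v"
        using esc_self[OF vertex.prems(2)] vertex.prems(3) subset_trans[OF nbhd_esc[OF vN] N]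
        by (rule esc_least)
    qed
    moreover have "?Y \<subseteq> pverts G" using True C nbhd_subset_verts by blast
    moreover have escX: "esc G (?Y \<inter> X) v = ?C" using YX escN by simp
    ultimately have "monCR_rule G k X v ?Y" unfolding monCR_rule_def CR_rule_def by blast
    moreover have "cop_win G (monCR_rule G k) j ?Y u" if u: "u \<in> ?C" for u
    proof (cases "u \<in> ?Y")
      case False
      have C': "esc G ?Y u \<subseteq> ?C" using u False subset_insertI by (rule esc_least)
      have "nbhd G (esc G ?Y u) \<subseteq> ?Y" using False by (rule nbhd_esc)
      moreover have "esc G ?Y u \<subseteq> pverts G - ?Y" using False by (rule esc_subset)
      moreover have "u \<in> pverts G" "?N \<inter> R = {}" "?C \<subseteq> R" using u C vertex.prems by blast+
      ultimately have "esc G ?Y u \<subseteq> R - {y}" "nbhd G (esc G ?Y u) \<inter> (R - {y}) = {}"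
        using C' by blast+
      then show ?thesis
        using False vertex.prems(1) \<open>u \<in> pverts G\<close> by (intro vertex.IH) auto
    qed (rule cop_win_caught)
    ultimately show ?thesis
      unfolding cop_win.simps using escX by blast
  qed
qed

end

section \<open>Rooted forests\<close>

definition ancestors :: "'a rel \<Rightarrow> 'a \<Rightarrow> 'a set" where
  "ancestors F v = {u. (u, v) \<in> F\<^sup>*}"

definition subtree :: "'a rel \<Rightarrow> 'a \<Rightarrow> 'a set" where
  "subtree F w = {v. (w, v) \<in> F\<^sup>*}"

lemma subtree_self: "v \<in> subtree F v"
  by (simp add: subtree_def)

lemma rooted_forestD:
  assumes "rooted_forest V F"
  shows "F \<subseteq> V \<times> V" "acyclic F" "(u, v) \<in> F \<Longrightarrow> (u', v) \<in> F \<Longrightarrow> u = u'"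
  using assms unfolding rooted_forest_def by (blast, blast, metis)

lemma rooted_forest_finite:
  "rooted_forest V F \<Longrightarrow> finite V \<Longrightarrow> finite F"
  using finite_subset[OF rooted_forestD(1) finite_cartesian_product[of V V]] by blast

lemma rtrancl_in_verts:
  assumes "(u, v) \<in> F\<^sup>*" "F \<subseteq> V \<times> V"
  shows "u \<in> V \<longleftrightarrow> v \<in> V"
  using assms by (induction rule: rtrancl_induct) auto

text \<open>Parents are unique, so two upward walks from \<open>v\<close> run along the same
  path.\<close>

lemma ancestors_comparable:
  assumes "rooted_forest V F" "(u, v) \<in> F\<^sup>*" "(w, v) \<in> F\<^sup>*"
  shows "(u, w) \<in> F\<^sup>* \<or> (w, u) \<in> F\<^sup>*"
proof -
  have "single_valued (F\<inverse>)"
    using assms(1) unfolding rooted_forest_def single_valued_def by blast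
  from single_valued_confluent[OF this rtrancl_converseI[OF assms(2)] rtrancl_converseI[OF assms(3)]]
  show ?thesis by (simp add: rtrancl_converse disj_commute)
qed

lemma successively_rel:
  assumes "successively (\<lambda>u v. (u, v) \<in> F) xs" "xs \<noteq> []" "acyclic F"
  shows "distinct xs \<and> (\<forall>x \<in> set xs. (hd xs, x) \<in> F\<^sup>* \<and> (x, last xs) \<in> F\<^sup>*)"
  using assms
proof (induction xs)
  case (Cons x xs)
  show ?case
  proof (cases "xs = []")
    case False
    then have x: "(x, hd xs) \<in> F" "successively (\<lambda>u v. (u, v) \<in> F) xs"
      using Cons.prems(1) by (auto simp: successively_Cons)
    note IH = Cons.IH[OF x(2) False Cons.prems(3)]
    have t: "(x, y) \<in> F\<^sup>+" if "y \<in> set xs" for y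
      using x(1) by (rule rtrancl_into_trancl2) (use IH that in blast)
    have "x \<notin> set xs" using t[of x] Cons.prems(3) unfolding acyclic_def by blast
    moreover have "\<forall>y \<in> set (x # xs). (x, y) \<in> F\<^sup>*" by (simp add: t trancl_into_rtrancl)
    moreover have "\<forall>y \<in> set (x # xs). (y, last xs) \<in> F\<^sup>*"
      using IH trancl_into_rtrancl[OF t[OF last_in_set[OF False]]] False by simp
    ultimately show ?thesis using IH by simp
  qed simp
qed simp

lemma finite_root_leaf_lengths:
  assumes "rooted_forest V F" "finite V"
  shows "finite (length ` root_leaf_paths V F)"
proof (rule finite_subset)
  show "length ` root_leaf_paths V F \<subseteq> {..card V}"
  proof
    fix n assume "n \<in> length ` root_leaf_paths V F"
    then obtain xs where xs: "n = length xs" "xs \<in> root_leaf_paths V F" by blast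
    then have "distinct xs" "set xs \<subseteq> V"
      using successively_rel[OF _ _ rooted_forestD(2)[OF assms(1)], of xs]
      by (simp_all add: root_leaf_paths_def)
    then have "length xs \<le> card V"
      using card_mono[OF assms(2)] by (simp add: distinct_card[symmetric])
    then show "n \<in> {..card V}" using xs(1) by simp
  qed
qed simp

lemma forest_depth_le:
  assumes "rooted_forest V F" "finite V" "\<And>v. v \<in> V \<Longrightarrow> card (ancestors F v) \<le> q"
  shows "forest_depth V F \<le> q"
proof -
  have "length xs \<le> q" if xs: "xs \<in> root_leaf_paths V F" for xs
  proof -
    from xs have ne: "xs \<noteq> []" and V: "set xs \<subseteq> V"
      and s: "successively (\<lambda>u v. (u, v) \<in> F) xs" by (auto simp: root_leaf_paths_def)
    from successively_rel[OF s ne rooted_forestD(2)[OF assms(1)]]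
    have d: "distinct xs" and sub: "set xs \<subseteq> ancestors F (last xs)"
      by (auto simp: ancestors_def)
    have l: "last xs \<in> V" using ne V by auto
    have "ancestors F (last xs) \<subseteq> V"
      using l rtrancl_in_verts[OF _ rooted_forestD(1)[OF assms(1)]] by (auto simp: ancestors_def)
    then have "card (set xs) \<le> card (ancestors F (last xs))"
      using sub assms(2) by (meson card_mono finite_subset)
    then show ?thesis using assms(3)[OF l] distinct_card[OF d] by simp
  qed
  then show ?thesis
    unfolding forest_depth_def using finite_root_leaf_lengths[OF assms(1,2)] by auto
qed

lemma root_path_exists:
  assumes "rooted_forest V F" "finite V"
  shows "\<exists>xs. xs \<noteq> [] \<and> set xs = ancestors F l \<and> hd xs \<notin> Range F \<and> last xs = l \<and>
    successively (\<lambda>u v. (u, v) \<in> F) xs"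
proof -
  have "wf F" using assms rooted_forest_finite rooted_forestD(2) finite_acyclic_wf by blast
  then show ?thesis
  proof (induction l rule: wf_induct_rule)
    case (less l)
    show ?case
    proof (cases "l \<in> Range F")
      case False
      then have "ancestors F l = {l}" unfolding ancestors_def by (auto elim: rtranclE)
      then show ?thesis using False by (intro exI[of _ "[l]"]) auto
    next
      case True
      then obtain u where u: "(u, l) \<in> F" by blast
      from less[OF u] obtain xs where xs: "xs \<noteq> []" "set xs = ancestors F u" "hd xs \<notin> Range F"
        "last xs = u" "successively (\<lambda>u v. (u, v) \<in> F) xs" by blast
      have "(x, u) \<in> F\<^sup>*" if "(x, l) \<in> F\<^sup>*" "x \<noteq> l" for x
        using that(1) by (cases rule: rtranclE) (use that(2) u rooted_forestD(3)[OF assms(1)] in blast)+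
      then have "ancestors F l = insert l (ancestors F u)"
        using u unfolding ancestors_def by (auto intro: rtrancl_into_rtrancl)
      then show ?thesis using xs u
        by (intro exI[of _ "xs @ [l]"]) (auto simp: successively_append_iff)
    qed
  qed
qed

text \<open>A deepest descendant \<open>l\<close> of \<open>v\<close> is a leaf, and the path from
  its root passes through all ancestors of \<open>v\<close>.\<close>

lemma card_ancestors_le_depth:
  assumes "rooted_forest V F" "finite V" "v \<in> V"
  shows "card (ancestors F v) \<le> forest_depth V F"
proof -
  have "wf (F\<inverse>)"
    using assms rooted_forest_finite rooted_forestD(2) finite_acyclic_wf_converse by blast
  from wfE_min[OF this subtree_self] obtain l
    where l: "l \<in> subtree F v" "\<And>y. (y, l) \<in> F\<inverse> \<Longrightarrow> y \<notin> subtree F v" by blast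
  then have vl: "(v, l) \<in> F\<^sup>*" by (simp add: subtree_def)
  have leaf: "l \<notin> Domain F"
    using l(2) rtrancl_into_rtrancl[OF vl] unfolding subtree_def by blast
  from root_path_exists[OF assms(1,2), of l] obtain xs where xs: "xs \<noteq> []" "set xs = ancestors F l"
    "hd xs \<notin> Range F" "last xs = l" "successively (\<lambda>u v. (u, v) \<in> F) xs" by blast
  have "l \<in> V" using rtrancl_in_verts[OF vl rooted_forestD(1)[OF assms(1)]] assms(3) by simp
  then have "ancestors F l \<subseteq> V"
    using rtrancl_in_verts[OF _ rooted_forestD(1)[OF assms(1)]] by (auto simp: ancestors_def)
  then have "xs \<in> root_leaf_paths V F" using xs leaf by (simp add: root_leaf_paths_def)
  then have "length xs \<le> forest_depth V F"
    unfolding forest_depth_def using finite_root_leaf_lengths[OF assms(1,2)] by simp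
  moreover have "ancestors F v \<subseteq> set xs"
    unfolding xs(2) ancestors_def using rtrancl_trans[OF _ vl] by blast
  then have "card (ancestors F v) \<le> card (set xs)" by (intro card_mono) simp
  ultimately show ?thesis using card_length[of xs] by linarith
qed

text \<open>No pair of \<open>F'\<close> starts in \<open>A\<close>, so a walk from \<open>A\<close>
  never uses one. This serves both disjoint unions of forests and a new root, whose pairs start
  outside the old forest.\<close>

lemma rtrancl_Un_invariant:
  assumes "(u, v) \<in> (F \<union> F')\<^sup>*" "u \<in> A" "F \<subseteq> A \<times> A" "F' \<inter> A \<times> UNIV = {}"
  shows "(u, v) \<in> F\<^sup>* \<and> v \<in> A"
  using assms
proof (induction rule: rtrancl_induct)
  case (step y z)
  then have "(u, y) \<in> F\<^sup>*" "y \<in> A" by auto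
  moreover have "(y, z) \<in> F" using step \<open>y \<in> A\<close> by auto
  ultimately show ?case using step.prems by (auto intro: rtrancl_into_rtrancl)
qed simp

lemma trancl_Un_invariant:
  assumes "(u, v) \<in> (F \<union> F')\<^sup>+" "u \<in> A" "F \<subseteq> A \<times> A" "F' \<inter> A \<times> UNIV = {}"
  shows "(u, v) \<in> F\<^sup>+"
proof -
  from assms(1) obtain y where y: "(u, y) \<in> F \<union> F'" "(y, v) \<in> (F \<union> F')\<^sup>*" by (meson tranclD)
  then have "(u, y) \<in> F" "y \<in> A" using assms by auto
  with rtrancl_Un_invariant[OF y(2) _ assms(3,4)] show ?thesis
    by (auto intro: rtrancl_into_trancl2)
qed

lemma subtree_Un:
  assumes "w \<in> A" "F \<subseteq> A \<times> A" "F' \<inter> A \<times> UNIV = {}"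
  shows "subtree (F \<union> F') w = subtree F w"
  using rtrancl_Un_invariant[OF _ assms] rtrancl_mono[of F "F \<union> F'"]
  unfolding subtree_def by blast

lemma acyclic_Un_invariant:
  assumes "acyclic F" "acyclic F'" "F \<subseteq> A \<times> A" "F' \<inter> A \<times> UNIV = {}" "F' \<subseteq> B \<times> B" "F \<inter> B \<times> UNIV = {}"
  shows "acyclic (F \<union> F')"
  unfolding acyclic_def
proof (intro allI notI)
  fix x assume x: "(x, x) \<in> (F \<union> F')\<^sup>+"
  then obtain y where "(x, y) \<in> F \<union> F'" by (meson tranclD)
  then have "x \<in> A \<or> x \<in> B" using assms by auto
  then show False
    using trancl_Un_invariant[OF x _ assms(3,4)] trancl_Un_invariant[of x x F' F B] x assms
    by (auto simp: acyclic_def Un_commute)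
qed

section \<open>Elimination schemes, narrow forests and pebblings\<close>

context pair_graph
begin

text \<open>A pebble forest cover without its pebbles: the number of vertices above \<open>w\<close>
  with a neighbour in the subtree of \<open>w\<close> replaces the map \<open>p\<close>. Depth is
  measured by counting ancestors.\<close>

definition narrow_forest :: "nat \<Rightarrow> nat \<Rightarrow> 'a set \<Rightarrow> 'a rel \<Rightarrow> bool" where
  "narrow_forest k j R F \<longleftrightarrow>
     rooted_forest R F \<and>
     (\<forall>u \<in> R. \<forall>v \<in> R. (u, v) \<in> parcs G \<longrightarrow> (u, v) \<in> F\<^sup>* \<or> (v, u) \<in> F\<^sup>*) \<and>
     (\<forall>w \<in> R. card (nbhd G (subtree F w)) < k) \<and>
     (\<forall>v \<in> R. card (ancestors F v) \<le> j)"

lemma narrow_forest_Un: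
  assumes F: "narrow_forest k j R F" and F': "narrow_forest k j R' F'"
    and disj: "R \<inter> R' = {}" "nbhd G R \<inter> R' = {}"
  shows "narrow_forest k j (R \<union> R') (F \<union> F')"
proof -
  have rf: "rooted_forest R F" "rooted_forest R' F'" using F F' by (simp_all add: narrow_forest_def)
  note sub = rooted_forestD(1)[OF rf(1)] rooted_forestD(1)[OF rf(2)]
  have d: "F' \<inter> R \<times> UNIV = {}" "F \<inter> R' \<times> UNIV = {}" using sub disj(1) by blast+
  have sub': "subtree (F \<union> F') w = subtree F' w" if "w \<in> R'" for w
    using subtree_Un[OF that sub(2) d(2)] by (simp add: Un_commute)
  have inR: "(u, v) \<in> F\<^sup>*" if "(u, v) \<in> (F \<union> F')\<^sup>*" "v \<in> R" for u v
  proof -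
    have "u \<in> R \<union> R'" using rtrancl_in_verts[OF that(1), of "R \<union> R'"] sub that(2) by blast
    moreover have "u \<notin> R'"
      using rtrancl_Un_invariant[OF _ _ sub(2) d(2), of u v] that disj(1) by (auto simp: Un_commute)
    ultimately show ?thesis using rtrancl_Un_invariant[OF that(1) _ sub(1) d(1)] by blast
  qed
  have inR': "(u, v) \<in> F'\<^sup>*" if "(u, v) \<in> (F \<union> F')\<^sup>*" "v \<in> R'" for u v
  proof -
    have "u \<in> R \<union> R'" using rtrancl_in_verts[OF that(1), of "R \<union> R'"] sub that(2) by blast
    moreover have "u \<notin> R"
      using rtrancl_Un_invariant[OF that(1) _ sub(1) d(1)] that disj(1) by blast
    ultimately show ?thesis
      using rtrancl_Un_invariant[OF _ _ sub(2) d(2), of u v] that by (auto simp: Un_commute)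
  qed
  have anc: "ancestors (F \<union> F') v = ancestors F v" if "v \<in> R" for v
    using inR[OF _ that] rtrancl_mono[of F "F \<union> F'"] unfolding ancestors_def by blast
  have anc': "ancestors (F \<union> F') v = ancestors F' v" if "v \<in> R'" for v
    using inR'[OF _ that] rtrancl_mono[of F' "F \<union> F'"] unfolding ancestors_def by blast
  have "acyclic (F \<union> F')"
    using rooted_forestD(2)[OF rf(1)] rooted_forestD(2)[OF rf(2)] sub(1) d(1) sub(2) d(2)
    by (rule acyclic_Un_invariant)
  then have "rooted_forest (R \<union> R') (F \<union> F')"
    using sub disj(1) rooted_forestD(3)[OF rf(1)] rooted_forestD(3)[OF rf(2)]
    unfolding rooted_forest_def by blast
  moreover have "(u, v) \<in> (F \<union> F')\<^sup>* \<or> (v, u) \<in> (F \<union> F')\<^sup>*"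
    if uv: "u \<in> R \<union> R'" "v \<in> R \<union> R'" "(u, v) \<in> parcs G" for u v
  proof -
    have "u \<in> R \<and> v \<in> R \<or> u \<in> R' \<and> v \<in> R'"
      using uv disj arcs_symmetric[OF uv(3)] by (auto simp: nbhd_def)
    then have "(u, v) \<in> F\<^sup>* \<or> (v, u) \<in> F\<^sup>* \<or> (u, v) \<in> F'\<^sup>* \<or> (v, u) \<in> F'\<^sup>*"
      using F F' uv(3) unfolding narrow_forest_def by blast
    then show ?thesis using rtrancl_mono[of F "F \<union> F'"] rtrancl_mono[of F' "F \<union> F'"] by blast
  qed
  ultimately show ?thesis
    using F F' anc anc' sub' subtree_Un[OF _ sub(1) d(1)] unfolding narrow_forest_def by auto
qed

text \<open>\<open>r\<close> becomes the parent of all roots of \<open>F\<close>. Its subtree is all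
  of \<open>R\<close>, and the other subtrees do not change.\<close>

lemma narrow_forest_insert_root:
  assumes F: "narrow_forest k j (R - {r}) F" and r: "r \<in> R" "card (nbhd G R) < k" and "finite R"
  shows "narrow_forest k (Suc j) R (F \<union> {r} \<times> (R - {r} - Range F))"
proof -
  let ?E = "{r} \<times> (R - {r} - Range F)"
  let ?F = "F \<union> ?E"
  have rf: "rooted_forest (R - {r}) F" using F by (simp add: narrow_forest_def)
  note sub = rooted_forestD(1)[OF rf]
  have d: "?E \<inter> (R - {r}) \<times> UNIV = {}" by blast
  have subF: "?F \<subseteq> R \<times> R" using sub r by blast
  have rin: "r \<notin> Range ?F" using sub by blast
  have "wf F"
    using rooted_forest_finite[OF rf] rooted_forestD(2)[OF rf] assms(4) finite_acyclic_wf by blast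
  then have reach: "u \<in> R \<Longrightarrow> (r, u) \<in> ?F\<^sup>*" for u
  proof (induction u rule: wf_induct_rule)
    case (less u)
    show ?case
    proof (cases "u = r \<or> u \<notin> Range F")
      case False
      then obtain y where y: "(y, u) \<in> F" by blast
      then have "(r, y) \<in> ?F\<^sup>*" using less.IH[OF y] sub by blast
      then show ?thesis using y by (meson UnI1 rtrancl_into_rtrancl)
    qed (use less.prems in \<open>auto intro: r_into_rtrancl\<close>)
  qed
  have subtree_r: "subtree ?F r = R"
    using reach rtrancl_in_verts[OF _ subF] r unfolding subtree_def by blast
  have anc: "ancestors ?F u \<subseteq> insert r (ancestors F u)" if u: "u \<in> R" for u
  proof
    fix w assume "w \<in> ancestors ?F u"
    then have w: "(w, u) \<in> ?F\<^sup>*" by (simp add: ancestors_def)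
    have "w \<in> R" using rtrancl_in_verts[OF w subF] u by blast
    then show "w \<in> insert r (ancestors F u)"
      using rtrancl_Un_invariant[OF w _ sub d] by (auto simp: ancestors_def)
  qed
  have "card (ancestors ?F u) \<le> Suc j" if u: "u \<in> R" for u
  proof (cases "u = r")
    case True
    have "ancestors ?F r = {r}" using rin unfolding ancestors_def by (auto elim: rtranclE)
    then show ?thesis using True by simp
  next
    case False
    then have uR: "u \<in> R - {r}" using u by simp
    then have "ancestors F u \<subseteq> R"
      using rtrancl_in_verts[OF _ sub] by (auto simp: ancestors_def)
    then have "finite (ancestors F u)" using assms(4) by (rule finite_subset)
    then have "card (ancestors ?F u) \<le> card (insert r (ancestors F u))"
      using anc[OF u] by (intro card_mono) auto
    also have "\<dots> \<le> Suc (card (ancestors F u))" by (simp add: card_insert_if \<open>finite (ancestors F u)\<close>)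
    also have "\<dots> \<le> Suc j" using F uR unfolding narrow_forest_def by auto
    finally show ?thesis .
  qed
  moreover have "card (nbhd G (subtree ?F w)) < k" if "w \<in> R" for w
  proof (cases "w = r")
    case False
    then have w: "w \<in> R - {r}" using that by simp
    show ?thesis unfolding subtree_Un[OF w sub d] using F w unfolding narrow_forest_def by blast
  qed (use subtree_r r in simp)
  moreover have "(u, v) \<in> ?F\<^sup>* \<or> (v, u) \<in> ?F\<^sup>*"
    if uv: "u \<in> R" "v \<in> R" "(u, v) \<in> parcs G" for u v
  proof (cases "u = r \<or> v = r")
    case False
    then have "(u, v) \<in> F\<^sup>* \<or> (v, u) \<in> F\<^sup>*" using F uv unfolding narrow_forest_def by blast
    then show ?thesis using rtrancl_mono[of F ?F] by blast
  qed (use reach uv in auto)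
  moreover have "acyclic ?F"
    unfolding acyclic_def
  proof (intro allI notI)
    fix x assume x: "(x, x) \<in> ?F\<^sup>+"
    then have "x \<in> Range ?F" by (meson Range_iff tranclD2)
    then have "x \<in> R - {r}" using rin subF by auto
    from trancl_Un_invariant[OF x this sub d] show False
      using rooted_forestD(2)[OF rf] by (simp add: acyclic_def)
  qed
  moreover have "u = u'" if "(u, v) \<in> ?F" "(u', v) \<in> ?F" for u u' v
    using that rooted_forestD(3)[OF rf] by blast
  ultimately show ?thesis
    using subF unfolding narrow_forest_def rooted_forest_def by blast
qed

lemma elim_dec_imp_narrow_forest:
  "elim_dec k j R \<Longrightarrow> R \<subseteq> pverts G \<Longrightarrow> \<exists>F. narrow_forest k j R F"
proof (induction rule: elim_dec.induct)
  case (empty j)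
  show ?case
    by (rule exI[of _ "{}"]) (simp add: narrow_forest_def rooted_forest_def acyclic_def)
next
  case (split j R R')
  then show ?case using narrow_forest_Un by (metis le_sup_iff)
next
  case (vertex v R j)
  then obtain F where "narrow_forest k j (R - {v}) F" by blast
  from narrow_forest_insert_root[OF this vertex.hyps(1,2)] show ?case
    using vertex.prems pair_finite_verts finite_subset by blast
qed

text \<open>Edges join comparable vertices, so an edge can leave a subtree only upwards, to a proper
  ancestor of \<open>w\<close>.\<close>

lemma nbhd_subtree:
  assumes "rooted_forest (pverts G) F" "\<forall>(u, v) \<in> parcs G. (u, v) \<in> F\<^sup>* \<or> (v, u) \<in> F\<^sup>*"
    and "b \<in> nbhd G (subtree F w)"
  obtains a where "(b, w) \<in> F\<^sup>+" "(w, a) \<in> F\<^sup>*" "(b, a) \<in> parcs G" "(b, a) \<in> F\<^sup>+"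
proof -
  from assms(3) obtain a where a: "(w, a) \<in> F\<^sup>*" "(a, b) \<in> parcs G" and b: "(w, b) \<notin> F\<^sup>*"
    by (auto simp: nbhd_def subtree_def)
  have "(a, b) \<notin> F\<^sup>*" using a(1) b by (meson rtrancl_trans)
  then have ba: "(b, a) \<in> F\<^sup>*" using assms(2) a(2) by blast
  from ancestors_comparable[OF assms(1) ba a(1)] b have bw: "(b, w) \<in> F\<^sup>*" by blast
  moreover have "b \<noteq> w" using b by blast
  ultimately have bw': "(b, w) \<in> F\<^sup>+" by (meson rtranclD)
  then have "(b, a) \<in> F\<^sup>+" using a(1) by (rule trancl_rtrancl_trancl)
  with bw' a show thesis using that arcs_symmetric by blast
qed

text \<open>Pebbles are assigned greedily from the roots downwards: \<open>w\<close> avoids the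
  fewer than \<open>k\<close> pebbles on the boundary of its subtree.\<close>

lemma narrow_forest_imp_cover:
  assumes "narrow_forest k q (pverts G) F"
  shows "\<exists>p. pebble_forest_cover k G F p"
proof -
  let ?V = "pverts G"
  have rf: "rooted_forest ?V F" using assms by (simp add: narrow_forest_def)
  have "(u, v) \<in> F\<^sup>* \<or> (v, u) \<in> F\<^sup>*" if "(u, v) \<in> parcs G" for u v
    using assms that in_arcsD1[OF that] in_arcsD2[OF that] by (simp add: narrow_forest_def)
  then have edges: "\<forall>(u, v) \<in> parcs G. (u, v) \<in> F\<^sup>* \<or> (v, u) \<in> F\<^sup>*" by blast
  have "wf F"
    using rooted_forest_finite[OF rf pair_finite_verts] rooted_forestD(2)[OF rf]
    by (rule finite_acyclic_wf)
  then have "wf (F\<^sup>+)" by (rule wf_trancl)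
  then have "\<exists>p. \<forall>w. w \<in> ?V \<longrightarrow> p w \<in> {1..k} \<and> p w \<notin> p ` nbhd G (subtree F w)"
  \<comment> \<open>The first goal says that the constraint at \<open>w\<close> only depends on
    pebbles already assigned, as the boundary consists of proper ancestors.\<close>
  proof (rule dependent_wf_choice)
    fix f g :: "'a \<Rightarrow> nat" and w c
    assume eq: "\<And>z. (z, w) \<in> F\<^sup>+ \<Longrightarrow> f z = g z"
    have "f b = g b" if "b \<in> nbhd G (subtree F w)" for b
      by (rule nbhd_subtree[OF rf edges that], rule eq)
    then have "f ` nbhd G (subtree F w) = g ` nbhd G (subtree F w)" by simp
    then show "(w \<in> ?V \<longrightarrow> c \<in> {1..k} \<and> c \<notin> f ` nbhd G (subtree F w)) =
        (w \<in> ?V \<longrightarrow> c \<in> {1..k} \<and> c \<notin> g ` nbhd G (subtree F w))" by simp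
  next
    fix w and f :: "'a \<Rightarrow> nat"
    show "\<exists>c. w \<in> ?V \<longrightarrow> c \<in> {1..k} \<and> c \<notin> f ` nbhd G (subtree F w)"
    proof (cases "w \<in> ?V")
      case True
      then have "card (nbhd G (subtree F w)) < k"
        using assms unfolding narrow_forest_def by blast
      then have "card (f ` nbhd G (subtree F w)) < card {1..k}"
        using card_image_le[OF finite_nbhd, of f "subtree F w"] by simp
      then have "\<not> {1..k} \<subseteq> f ` nbhd G (subtree F w)"
        by (meson card_mono finite_imageI finite_nbhd leD)
      then show ?thesis by blast
    qed simp
  qed
  then obtain p where p: "\<And>w. w \<in> ?V \<Longrightarrow> p w \<in> {1..k} \<and> p w \<notin> p ` nbhd G (subtree F w)" by blast
  have "p u \<noteq> p w" if "(u, v) \<in> parcs G" "(u, w) \<in> F\<^sup>+" "(w, v) \<in> F\<^sup>*" for u v w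
  proof -
    have "w \<in> ?V"
      using rtrancl_in_verts[OF that(3) rooted_forestD(1)[OF rf]] in_arcsD2[OF that(1)] by simp
    moreover have "(w, u) \<notin> F\<^sup>*"
      using trancl_rtrancl_trancl[OF that(2), of u] rooted_forestD(2)[OF rf]
      unfolding acyclic_def by blast
    then have "u \<in> nbhd G (subtree F w)"
      using that(3) arcs_symmetric[OF that(1)] unfolding nbhd_def subtree_def by blast
    ultimately show ?thesis using p[of w] by (metis imageI)
  qed
  then have "\<forall>(u, v) \<in> parcs G. (u, v) \<in> F\<^sup>+ \<longrightarrow>
      (\<forall>w. (u, w) \<in> F\<^sup>+ \<and> (w, v) \<in> F\<^sup>* \<longrightarrow> p u \<noteq> p w)" by blast
  moreover have "p ` ?V \<subseteq> {1..k}" using p by blast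
  ultimately show ?thesis
    using rf edges by (intro exI[of _ p]) (simp add: pebble_forest_cover_def)
qed

text \<open>The boundary of the subtree is a chain above \<open>w\<close>. An edge from a boundary
  vertex into the subtree passes \<open>w\<close> and all lower boundary vertices, so
  \<open>w\<close> and the boundary carry distinct pebbles.\<close>

lemma pebble_forest_cover_narrow:
  assumes "pebble_forest_cover k G F p" "w \<in> pverts G"
  shows "card (nbhd G (subtree F w)) < k"
proof -
  let ?B = "nbhd G (subtree F w)"
  have rf: "rooted_forest (pverts G) F"
    and edges: "\<forall>(u, v) \<in> parcs G. (u, v) \<in> F\<^sup>* \<or> (v, u) \<in> F\<^sup>*"
    and p: "p ` pverts G \<subseteq> {1..k}"
    and col: "\<And>u v x. (u, v) \<in> parcs G \<Longrightarrow> (u, v) \<in> F\<^sup>+ \<Longrightarrow> (u, x) \<in> F\<^sup>+ \<Longrightarrow> (x, v) \<in> F\<^sup>* \<Longrightarrow> p u \<noteq> p x"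
    using assms(1) unfolding pebble_forest_cover_def by (blast, blast, blast, fast)
  have 1: "p b \<noteq> p w" if "b \<in> ?B" for b
    by (rule nbhd_subtree[OF rf edges that], rule col)
  have 2: "p b \<noteq> p c" if "b \<in> ?B" "c \<in> ?B" "(b, c) \<in> F\<^sup>+" for b c
  proof -
    from nbhd_subtree[OF rf edges that(1)] obtain a where
      a: "(w, a) \<in> F\<^sup>*" "(b, a) \<in> parcs G" "(b, a) \<in> F\<^sup>+" .
    from nbhd_subtree[OF rf edges that(2)] have "(c, w) \<in> F\<^sup>+" .
    with a(1) have "(c, a) \<in> F\<^sup>*" by (meson trancl_into_rtrancl rtrancl_trans)
    with col[OF a(2,3) that(3)] show ?thesis .
  qed
  have 3: "p b \<noteq> p c" if "b \<in> ?B" "c \<in> ?B" "b \<noteq> c" for b c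
  proof -
    from nbhd_subtree[OF rf edges that(1)] have "(b, w) \<in> F\<^sup>+" .
    moreover from nbhd_subtree[OF rf edges that(2)] have "(c, w) \<in> F\<^sup>+" .
    ultimately have "(b, c) \<in> F\<^sup>* \<or> (c, b) \<in> F\<^sup>*"
      by (intro ancestors_comparable[OF rf, of _ w]) (auto intro: trancl_into_rtrancl)
    then have "(b, c) \<in> F\<^sup>+ \<or> (c, b) \<in> F\<^sup>+" using that(3) by (metis rtranclD)
    then show ?thesis using 2[OF that(1,2)] 2[OF that(2,1)] by metis
  qed
  have "inj_on p (insert w ?B)" using 1 3 by (intro inj_onI) (metis insertE)
  moreover have "p ` insert w ?B \<subseteq> {1..k}" using p assms(2) nbhd_subset_verts by blast
  ultimately have "card (insert w ?B) \<le> card {1..k}" by (meson card_inj_on_le finite_atLeastAtMost)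
  moreover have "w \<notin> ?B" by (simp add: nbhd_def subtree_self)
  ultimately show ?thesis by (simp add: card_insert_if)
qed

text \<open>\<open>R\<close> is closed under children and is consumed from the top: a topmost vertex
  \<open>r\<close> is removed if its subtree is all of \<open>R\<close>, otherwise its subtree is
  split off.\<close>

lemma cover_imp_elim_dec:
  assumes cover: "pebble_forest_cover k G F p"
    and "R \<subseteq> pverts G" "F `` R \<subseteq> R" "\<And>v. v \<in> R \<Longrightarrow> card (ancestors F v \<inter> R) \<le> j"
  shows "elim_dec k j R"
proof -
  have rf: "rooted_forest (pverts G) F"
    and edges: "\<forall>(u, v) \<in> parcs G. (u, v) \<in> F\<^sup>* \<or> (v, u) \<in> F\<^sup>*"
    using cover unfolding pebble_forest_cover_def by blast+
  have "wf F"
    using rooted_forest_finite[OF rf pair_finite_verts] rooted_forestD(2)[OF rf]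
    by (rule finite_acyclic_wf)
  have "finite R" using assms(2) pair_finite_verts by (rule finite_subset)
  then show ?thesis using assms(2-4)
  proof (induction arbitrary: j rule: finite_psubset_induct)
    case (psubset R)
    have closed: "v \<in> R" if "(u, v) \<in> F\<^sup>*" "u \<in> R" for u v
      using that psubset.prems(2) by (induction rule: rtrancl_induct) auto
    show ?case
    proof (cases "R = {}")
      case False
      then obtain r where r: "r \<in> R" "\<And>y. (y, r) \<in> F \<Longrightarrow> y \<notin> R"
        using wfE_min[OF \<open>wf F\<close>] by (metis ex_in_conv)
      let ?D = "subtree F r"
      have D: "?D \<subseteq> R" using closed r(1) by (auto simp: subtree_def)
      have rV: "r \<in> pverts G" using r psubset.prems by blast
      have nr: "(u, r) \<notin> F" if "u \<in> R" for u using r(2) that by blast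
      show ?thesis
      proof (cases "?D = R")
        case True
        have fin: "finite (ancestors F v \<inter> R)" for v using psubset.hyps by simp
        have rm: "r \<in> ancestors F v \<inter> R" if "v \<in> R" for v
          using that True r(1) by (auto simp: ancestors_def subtree_def)
        have "0 < card (ancestors F r \<inter> R)" using rm[OF r(1)] fin card_gt_0_iff by blast
        then obtain j' where j: "j = Suc j'"
          using psubset.prems(3)[OF r(1)] by (cases j) auto
        have "elim_dec k j' (R - {r})"
        proof (rule psubset.IH)
          show "R - {r} \<subset> R" using r(1) by blast
          show "R - {r} \<subseteq> pverts G" using psubset.prems(1) by blast
          show "F `` (R - {r}) \<subseteq> R - {r}" using psubset.prems(2) nr by blast
          fix v assume v: "v \<in> R - {r}"
          \<comment> \<open>Every vertex of \<open>R\<close> lies below \<open>r\<close>, so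
            removing \<open>r\<close> lowers each count by exactly one.\<close>
          have "ancestors F v \<inter> (R - {r}) = ancestors F v \<inter> R - {r}" by blast
          moreover have "card (ancestors F v \<inter> R - {r}) = card (ancestors F v \<inter> R) - 1"
            using v rm by (intro card_Diff_singleton) blast
          ultimately show "card (ancestors F v \<inter> (R - {r})) \<le> j'"
            using psubset.prems(3)[of v] v j by simp
        qed
        with r(1) pebble_forest_cover_narrow[OF cover rV, unfolded True] show ?thesis
          unfolding j by (rule elim_dec.vertex)
      next
        case False
        have mono: "card (ancestors F v \<inter> A) \<le> j" if "A \<subseteq> R" "v \<in> A" for v A
        proof -
          have "card (ancestors F v \<inter> A) \<le> card (ancestors F v \<inter> R)"
            using that(1) psubset.hyps by (intro card_mono) auto
          also have "\<dots> \<le> j" using that by (intro psubset.prems(3)) blast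
          finally show ?thesis .
        qed
        have par: "u \<in> ?D" if uv: "(u, v) \<in> F" "v \<in> ?D" "u \<in> R" for u v
        proof -
          have "v \<noteq> r" using nr uv by blast
          moreover have "(r, v) \<in> F\<^sup>*" using uv by (simp add: subtree_def)
          ultimately obtain y where y: "(r, y) \<in> F\<^sup>*" "(y, v) \<in> F" by (metis rtranclE)
          have "u = y" using rf uv(1) y(2) by (rule rooted_forestD(3))
          with y(1) show ?thesis by (simp add: subtree_def)
        qed
        have 1: "elim_dec k j ?D"
        proof (rule psubset.IH)
          show "?D \<subset> R" using D False by blast
          show "?D \<subseteq> pverts G" using D psubset.prems(1) by blast
          show "F `` ?D \<subseteq> ?D" by (auto simp: subtree_def intro: rtrancl_into_rtrancl)
        qed (rule mono[OF D])
        have 2: "elim_dec k j (R - ?D)"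
        proof (rule psubset.IH)
          show "R - ?D \<subset> R" using r(1) subtree_self[of r F] by blast
          show "R - ?D \<subseteq> pverts G" using psubset.prems(1) by blast
          show "F `` (R - ?D) \<subseteq> R - ?D" using psubset.prems(2) par by blast
        qed (rule mono[OF Diff_subset])
        have "nbhd G ?D \<inter> (R - ?D) = {}"
        proof -
          \<comment> \<open>Such a \<open>b\<close> is a proper ancestor of \<open>r\<close>; if it
            were in \<open>R\<close>, so would be the parent of \<open>r\<close>.\<close>
          have "b \<notin> R" if "b \<in> nbhd G ?D" for b
          proof
            assume b: "b \<in> R"
            from nbhd_subtree[OF rf edges that] have "(b, r) \<in> F\<^sup>+" .
            then obtain y where "(b, y) \<in> F\<^sup>*" "(y, r) \<in> F" by (meson tranclD2)
            then show False using closed b nr by blast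
          qed
          then show ?thesis by blast
        qed
        with elim_dec.split[OF 1 2 Diff_disjoint] have "elim_dec k j (?D \<union> (R - ?D))" .
        then show ?thesis using D by (simp add: Un_absorb1)
      qed
    qed (simp add: elim_dec.empty)
  qed
qed

lemma cover_class_iff_elim_dec:
  "G \<in> bounded_forest_cover_class k q \<longleftrightarrow> elim_dec k q (pverts G)"
proof
  assume "G \<in> bounded_forest_cover_class k q"
  then obtain F p where cover: "pebble_forest_cover k G F p" and depth: "forest_depth (pverts G) F \<le> q"
    by (auto simp: bounded_forest_cover_class_def)
  have rf: "rooted_forest (pverts G) F" using cover by (simp add: pebble_forest_cover_def)
  show "elim_dec k q (pverts G)"
    using cover subset_refl
  proof (rule cover_imp_elim_dec)
    show "F `` pverts G \<subseteq> pverts G" using rooted_forestD(1)[OF rf] by blast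
    fix v assume v: "v \<in> pverts G"
    have "ancestors F v \<subseteq> pverts G"
      using v rtrancl_in_verts[OF _ rooted_forestD(1)[OF rf]] by (auto simp: ancestors_def)
    then show "card (ancestors F v \<inter> pverts G) \<le> q"
      using card_ancestors_le_depth[OF rf pair_finite_verts v] depth by (simp add: Int_absorb2)
  qed
next
  assume "elim_dec k q (pverts G)"
  then obtain F where F: "narrow_forest k q (pverts G) F"
    using elim_dec_imp_narrow_forest by blast
  then have "forest_depth (pverts G) F \<le> q"
    using pair_finite_verts by (intro forest_depth_le) (auto simp: narrow_forest_def)
  with narrow_forest_imp_cover[OF F] show "G \<in> bounded_forest_cover_class k q"
    using pair_graph by (auto simp: bounded_forest_cover_class_def)
qed

section \<open>Closing the circle of implications\<close>

lemma cop_wins_CR_imp_elim_dec: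
  assumes "cop_wins_CR k q G"
  shows "elim_dec k q (pverts G)"
proof -
  have "cop_win G (CR_rule G k) q {} v" if "v \<in> pverts G" for v
    using assms that unfolding cop_wins_CR_def cop_win_iff_strategy by blast
  \<comment> \<open>Before the first round the branch is empty and all \<open>q\<close> rounds
    remain.\<close>
  then have "partial_dec k q q 0 {} (pverts G)"
    by (intro partial_dec_trapped[where Y = "{}"]) auto
  then have "partial_dec k q 0 0 {} (pverts G)" by (rule partial_dec_level_zero)
  from partial_dec_imp_elim_dec[OF this] show ?thesis by simp
qed

lemma elim_dec_imp_cop_wins_monCR:
  assumes "elim_dec k q (pverts G)"
  shows "cop_wins_monCR k q G"
  unfolding cop_wins_monCR_def cop_win_iff_strategy
proof
  fix v assume v: "v \<in> pverts G"
  have "esc G {} v \<subseteq> pverts G" "nbhd G (esc G {} v) = {}"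
    using esc_subset[of v "{}"] nbhd_esc[of v "{}"] by auto
  then show "cop_win G (monCR_rule G k) q {} v"
    using v by (intro elim_dec_imp_cop_win_mon[OF assms]) auto
qed

end

lemma cop_wins_monCR_imp_CR: "cop_wins_monCR k q G \<Longrightarrow> cop_wins_CR k q G"
  unfolding cop_wins_monCR_def cop_wins_CR_def cop_win_iff_strategy
  using cop_win_rule_mono[of "monCR_rule G k" "CR_rule G k"] by (auto simp: monCR_rule_def)

theorem theorem4p1:
  fixes G :: "'a pair_pre_digraph" and q k :: nat
  assumes "pair_graph G" and "q \<ge> 1" and "k \<ge> 1"
  shows "(cop_wins_monCR k q G \<longleftrightarrow> cop_wins_CR k q G) \<and>
         (cop_wins_CR k q G \<longleftrightarrow> G \<in> bounded_forest_cover_class k q)"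
proof -
  interpret pair_graph G by fact
  show ?thesis
    using cop_wins_monCR_imp_CR cop_wins_CR_imp_elim_dec elim_dec_imp_cop_wins_monCR
      cover_class_iff_elim_dec by blast
qed

end
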